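(* Let $X\subseteq\mathbb{R}^d$ and $\Omega\subseteq\mathbb{R}^D$ be closed and let $\varphi\in C_0(X\times\Omega)$. Then $\mathcal{F}(X,\Omega)$ and $\mathcal{G}(\Omega,X)$ form an adjoint pair of RKBS with the reproducing kernel $K=\varphi$.
   Context: $C_0$ denotes continuous real functions vanishing at infinity, with the supremum norm. $\mathcal{M}(S)$ is the Banach space of signed, finite, regular Borel (Radon) measures on $S$ with total variation norm $\|\mu\|_{\mathcal{M}(S)}=|\mu|(S)$. For $\mu\in\mathcal{M}(\Omega)$ let $(A\mu)(x)=\int_\Omega\varphi(x,w)\,d\mu(w)$, $x\in X$; $\mathcal{F}(X,\Omega):=\{f:X\to\mathbb{R}\mid\exists\mu\in\mathcal{M}(\Omega),\ f=A\mu\}$ with norm $\|f\|_{\mathcal{F}(X,\Omega)}:=\inf_{f=A\mu}\|\mu\|_{\mathcal{M}(\Omega)}$. For $\rho\in\mathcal{M}(X)$ let $(A^*\rho)(w)=\int_X\varphi(x,w)\,d\rho(x)$, $w\in\Omega$; $\mathcal{G}(\Omega,X):=\{g\in C_0(\Omega)\mid\exists\rho\in\mathcal{M}(X),\ A^*\rho=g\}$ with norm $\|g\|_{\mathcal{G}(\Omega,X)}:=\|g\|_{C_0(\Omega)}$. The pairing between $f=A\mu\in\mathcal{F}(X,\Omega)$ and $g=A^*\rho\in\mathcal{G}(\Omega,X)$ is $\langle f,g\rangle:=\int_{X\times\Omega}\varphi(x,w)\,d(\rho\times\mu)(x,w)$, independent of the choice of $\mu,\rho$. A Banach space $\mathcal{B}$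 of functions on a set $X$ is an RKBS (reproducing kernel Banach space) on $X$ if for every $x\in X$ there is $C_x>0$ with $|f(x)|\le C_x\|f\|_{\mathcal{B}}$ for all $f\in\mathcal{B}$. Adjoint pair: let $\mathcal{B}$ be an RKBS on $X$. If there is a Banach space $\mathcal{B}^{\#}$ of functions on a set $\Omega$ that can be isomorphically embedded into $\mathcal{B}^*$, and a function $K:X\times\Omega\to\mathbb{R}$ with $K(x,\cdot)\in\mathcal{B}^{\#}$ and $f(x)=\langle K(x,\cdot),f\rangle$ for all $x\in X$, $f\in\mathcal{B}$, then $K$ is a reproducing kernel for $\mathcal{B}$. If in addition $\mathcal{B}^{\#}$ is an RKBS on $\Omega$, $K(\cdot,w)\in\mathcal{B}$ and $g(w)=\langle g,K(\cdot,w)\rangle$ for all $w\in\Omega$, $g\in\mathcal{B}^{\#}$, then $\mathcal{B}$ and $\mathcal{B}^{\#}$ are an adjoint pair of RKBS. Here $\mathcal{B}=\mathcal{F}(X,\Omega)$ and $\mathcal{B}^{\#}=\mathcal{G}(\Omega,X)$.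
   Formalization: G(Ω,X) with the supremum norm need not be complete, so the claim is proved for G without completeness, and as a full adjoint pair for the closure of G in C_0(Ω), with a pairing extending ⟨f,g⟩; if G is complete this is the original claim. *)

theory Defs
  imports "HOL-Analysis.Analysis"
begin

text \<open>
  A real function on a set \<open>S\<close> is represented by a total function that is \<open>0\<close> outside \<open>S\<close>,
  so that equality of representatives is equality on \<open>S\<close> and the pointwise operations stay
  within the representatives. Likewise a set function on the Borel sets of \<open>S\<close> is \<open>0\<close> on all
  other sets.
\<close>

subsection \<open>Continuous functions vanishing at infinity\<close>

definition C0 :: "'a::topological_space set \<Rightarrow> ('a \<Rightarrow> real) set" where
  "C0 S = {f. (\<forall>x. x \<notin> S \<longrightarrow> f x = 0) \<and> continuous_on S f \<and>
              (\<forall>\<epsilon>>0. \<exists>K\<subseteq>S. compact K \<and> (\<forall>x\<in>S - K. \<bar>f x\<bar> < \<epsilon>))}"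

text \<open>The inserted \<open>0\<close> only matters for empty \<open>S\<close>, where a real supremum is unspecified.\<close>

definition sup_norm :: "'a set \<Rightarrow> ('a \<Rightarrow> real) \<Rightarrow> real" where
  "sup_norm S f = Sup (insert 0 ((\<lambda>x. \<bar>f x\<bar>) ` S))"

subsection \<open>Signed regular Borel measures\<close>

abbreviation borel_sets_on :: "'a::topological_space set \<Rightarrow> 'a set set" where
  "borel_sets_on S \<equiv> sets (restrict_space borel S)"

definition signed_measure_on :: "'a::topological_space set \<Rightarrow> ('a set \<Rightarrow> real) \<Rightarrow> bool" where
  "signed_measure_on S \<mu> \<longleftrightarrow>
     (\<forall>E. E \<notin> borel_sets_on S \<longrightarrow> \<mu> E = 0) \<and>
     (\<forall>B::nat \<Rightarrow> 'a set. range B \<subseteq> borel_sets_on S \<longrightarrow> disjoint_family B \<longrightarrow>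
        (\<lambda>i. \<mu> (B i)) sums \<mu> (\<Union>i. B i))"

definition total_variation ::
    "'a::topological_space set \<Rightarrow> ('a set \<Rightarrow> real) \<Rightarrow> 'a measure" where
  "total_variation S \<mu> = measure_of S (borel_sets_on S)
     (\<lambda>E. SUP B\<in>{B::nat \<Rightarrow> 'a set.
                  range B \<subseteq> borel_sets_on S \<and> disjoint_family B \<and> (\<Union>i. B i) = E}.
            (\<Sum>i. ennreal \<bar>\<mu> (B i)\<bar>))"

definition pos_variation ::
    "'a::topological_space set \<Rightarrow> ('a set \<Rightarrow> real) \<Rightarrow> 'a measure" where
  "pos_variation S \<mu> = measure_of S (borel_sets_on S)
     (\<lambda>E. ennreal ((measure (total_variation S \<mu>) E + \<mu> E) / 2))"

definition neg_variation ::
    "'a::topological_space set \<Rightarrow> ('a set \<Rightarrow> real) \<Rightarrow> 'a measure" where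
  "neg_variation S \<mu> = measure_of S (borel_sets_on S)
     (\<lambda>E. ennreal ((measure (total_variation S \<mu>) E - \<mu> E) / 2))"

definition regular_on :: "'a::topological_space set \<Rightarrow> 'a measure \<Rightarrow> bool" where
  "regular_on S M \<longleftrightarrow> (\<forall>E\<in>borel_sets_on S.
     emeasure M E = (INF V\<in>{V. E \<subseteq> V \<and> openin (top_of_set S) V}. emeasure M V) \<and>
     emeasure M E = (SUP K\<in>{K. K \<subseteq> E \<and> compact K}. emeasure M K))"

definition Meas :: "'a::topological_space set \<Rightarrow> ('a set \<Rightarrow> real) set" where
  "Meas S = {\<mu>. signed_measure_on S \<mu> \<and> regular_on S (total_variation S \<mu>)}"

definition tv_norm :: "'a::topological_space set \<Rightarrow> ('a set \<Rightarrow> real) \<Rightarrow> real" where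
  "tv_norm S \<mu> = measure (total_variation S \<mu>) S"

definition signed_integral ::
    "'a::topological_space set \<Rightarrow> ('a set \<Rightarrow> real) \<Rightarrow> ('a \<Rightarrow> real) \<Rightarrow> real" where
  "signed_integral S \<mu> f =
     (\<integral>x. f x \<partial>pos_variation S \<mu>) - (\<integral>x. f x \<partial>neg_variation S \<mu>)"

definition signed_prod ::
    "'a::topological_space set \<Rightarrow> 'b::topological_space set \<Rightarrow>
     ('a set \<Rightarrow> real) \<Rightarrow> ('b set \<Rightarrow> real) \<Rightarrow> ('a \<times> 'b) set \<Rightarrow> real" where
  "signed_prod S T \<rho> \<mu> E = (if E \<in> borel_sets_on (S \<times> T) then
       measure (pos_variation S \<rho> \<Otimes>\<^sub>M pos_variation T \<mu>) E
     + measure (neg_variation S \<rho> \<Otimes>\<^sub>M neg_variation T \<mu>) E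
     - measure (pos_variation S \<rho> \<Otimes>\<^sub>M neg_variation T \<mu>) E
     - measure (neg_variation S \<rho> \<Otimes>\<^sub>M pos_variation T \<mu>) E
     else 0)"

subsection \<open>Reproducing kernel Banach spaces and adjoint pairs\<close>

definition normed_fun_space :: "'a set \<Rightarrow> ('a \<Rightarrow> real) set \<Rightarrow> (('a \<Rightarrow> real) \<Rightarrow> real) \<Rightarrow> bool" where
  "normed_fun_space X B N \<longleftrightarrow>
     (\<forall>f\<in>B. \<forall>x. x \<notin> X \<longrightarrow> f x = 0) \<and>
     (\<lambda>x. 0) \<in> B \<and>
     (\<forall>f\<in>B. \<forall>g\<in>B. (\<lambda>x. f x + g x) \<in> B) \<and>
     (\<forall>c. \<forall>f\<in>B. (\<lambda>x. c * f x) \<in> B) \<and>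
     (\<forall>f\<in>B. 0 \<le> N f \<and> (N f = 0 \<longleftrightarrow> f = (\<lambda>x. 0))) \<and>
     (\<forall>c. \<forall>f\<in>B. N (\<lambda>x. c * f x) = \<bar>c\<bar> * N f) \<and>
     (\<forall>f\<in>B. \<forall>g\<in>B. N (\<lambda>x. f x + g x) \<le> N f + N g)"

definition banach_fun_space :: "'a set \<Rightarrow> ('a \<Rightarrow> real) set \<Rightarrow> (('a \<Rightarrow> real) \<Rightarrow> real) \<Rightarrow> bool" where
  "banach_fun_space X B N \<longleftrightarrow> normed_fun_space X B N \<and>
     (\<forall>\<sigma>::nat \<Rightarrow> 'a \<Rightarrow> real. (\<forall>n. \<sigma> n \<in> B) \<longrightarrow>
        (\<forall>\<epsilon>>0. \<exists>M. \<forall>m\<ge>M. \<forall>n\<ge>M. N (\<lambda>x. \<sigma> m x - \<sigma> n x) < \<epsilon>) \<longrightarrow>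
        (\<exists>f\<in>B. (\<lambda>n. N (\<lambda>x. \<sigma> n x - f x)) \<longlonglongrightarrow> 0))"

definition bounded_evaluations ::
    "'a set \<Rightarrow> ('a \<Rightarrow> real) set \<Rightarrow> (('a \<Rightarrow> real) \<Rightarrow> real) \<Rightarrow> bool" where
  "bounded_evaluations X B N \<longleftrightarrow> (\<forall>x\<in>X. \<exists>C>0. \<forall>f\<in>B. \<bar>f x\<bar> \<le> C * N f)"

definition rkbs :: "'a set \<Rightarrow> ('a \<Rightarrow> real) set \<Rightarrow> (('a \<Rightarrow> real) \<Rightarrow> real) \<Rightarrow> bool" where
  "rkbs X B N \<longleftrightarrow> banach_fun_space X B N \<and> bounded_evaluations X B N"

definition pre_rkbs :: "'a set \<Rightarrow> ('a \<Rightarrow> real) set \<Rightarrow> (('a \<Rightarrow> real) \<Rightarrow> real) \<Rightarrow> bool" where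
  "pre_rkbs X B N \<longleftrightarrow> normed_fun_space X B N \<and> bounded_evaluations X B N"

definition dual_elem ::
    "('a \<Rightarrow> real) set \<Rightarrow> (('a \<Rightarrow> real) \<Rightarrow> real) \<Rightarrow> (('a \<Rightarrow> real) \<Rightarrow> real) \<Rightarrow> bool" where
  "dual_elem B N L \<longleftrightarrow>
     (\<forall>f\<in>B. \<forall>g\<in>B. L (\<lambda>x. f x + g x) = L f + L g) \<and>
     (\<forall>c. \<forall>f\<in>B. L (\<lambda>x. c * f x) = c * L f) \<and>
     (\<exists>C. \<forall>f\<in>B. \<bar>L f\<bar> \<le> C * N f)"

definition dual_norm ::
    "('a \<Rightarrow> real) set \<Rightarrow> (('a \<Rightarrow> real) \<Rightarrow> real) \<Rightarrow> (('a \<Rightarrow> real) \<Rightarrow> real) \<Rightarrow> real" where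
  "dual_norm B N L = Sup {\<bar>L f\<bar> | f. f \<in> B \<and> N f \<le> 1}"

text \<open>
  The map \<open>g \<mapsto> P \<sqdot> g\<close> is a linear isomorphism, bounded in both directions, of \<open>B'\<close> onto a
  subspace of the dual of \<open>B\<close>; \<open>P f g\<close> is the resulting duality pairing.
\<close>

definition embeds_into_dual ::
    "('a \<Rightarrow> real) set \<Rightarrow> (('a \<Rightarrow> real) \<Rightarrow> real) \<Rightarrow>
     ('b \<Rightarrow> real) set \<Rightarrow> (('b \<Rightarrow> real) \<Rightarrow> real) \<Rightarrow>
     (('a \<Rightarrow> real) \<Rightarrow> ('b \<Rightarrow> real) \<Rightarrow> real) \<Rightarrow> bool" where
  "embeds_into_dual B N B' N' P \<longleftrightarrow>
     (\<forall>g\<in>B'. dual_elem B N (\<lambda>f. P f g)) \<and>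
     (\<forall>f\<in>B. \<forall>g\<in>B'. \<forall>h\<in>B'. P f (\<lambda>w. g w + h w) = P f g + P f h) \<and>
     (\<forall>f\<in>B. \<forall>c. \<forall>g\<in>B'. P f (\<lambda>w. c * g w) = c * P f g) \<and>
     (\<exists>c>0. \<exists>C. \<forall>g\<in>B'. c * N' g \<le> dual_norm B N (\<lambda>f. P f g) \<and>
                          dual_norm B N (\<lambda>f. P f g) \<le> C * N' g)"

text \<open>\<open>K\<close> is a function on \<open>X \<times> \<Omega>\<close>, hence \<open>0\<close> elsewhere, so its sections need no truncation.\<close>

definition adjoint_reproducing ::
    "'a set \<Rightarrow> ('a \<Rightarrow> real) set \<Rightarrow> (('a \<Rightarrow> real) \<Rightarrow> real) \<Rightarrow>
     'b set \<Rightarrow> ('b \<Rightarrow> real) set \<Rightarrow> (('b \<Rightarrow> real) \<Rightarrow> real) \<Rightarrow>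
     (('a \<Rightarrow> real) \<Rightarrow> ('b \<Rightarrow> real) \<Rightarrow> real) \<Rightarrow> ('a \<times> 'b \<Rightarrow> real) \<Rightarrow> bool" where
  "adjoint_reproducing X B N \<Omega> B' N' P K \<longleftrightarrow>
     embeds_into_dual B N B' N' P \<and>
     (\<forall>x\<in>X. (\<lambda>w. K (x, w)) \<in> B' \<and> (\<forall>f\<in>B. f x = P f (\<lambda>w. K (x, w)))) \<and>
     (\<forall>w\<in>\<Omega>. (\<lambda>x. K (x, w)) \<in> B \<and> (\<forall>g\<in>B'. g w = P (\<lambda>x. K (x, w)) g))"

definition adjoint_pair ::
    "'a set \<Rightarrow> ('a \<Rightarrow> real) set \<Rightarrow> (('a \<Rightarrow> real) \<Rightarrow> real) \<Rightarrow>
     'b set \<Rightarrow> ('b \<Rightarrow> real) set \<Rightarrow> (('b \<Rightarrow> real) \<Rightarrow> real) \<Rightarrow>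
     (('a \<Rightarrow> real) \<Rightarrow> ('b \<Rightarrow> real) \<Rightarrow> real) \<Rightarrow> ('a \<times> 'b \<Rightarrow> real) \<Rightarrow> bool" where
  "adjoint_pair X B N \<Omega> B' N' P K \<longleftrightarrow>
     rkbs X B N \<and> rkbs \<Omega> B' N' \<and> adjoint_reproducing X B N \<Omega> B' N' P K"

text \<open>The same without completeness of the second space.\<close>

definition adjoint_pre_pair ::
    "'a set \<Rightarrow> ('a \<Rightarrow> real) set \<Rightarrow> (('a \<Rightarrow> real) \<Rightarrow> real) \<Rightarrow>
     'b set \<Rightarrow> ('b \<Rightarrow> real) set \<Rightarrow> (('b \<Rightarrow> real) \<Rightarrow> real) \<Rightarrow>
     (('a \<Rightarrow> real) \<Rightarrow> ('b \<Rightarrow> real) \<Rightarrow> real) \<Rightarrow> ('a \<times> 'b \<Rightarrow> real) \<Rightarrow> bool" where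
  "adjoint_pre_pair X B N \<Omega> B' N' P K \<longleftrightarrow>
     rkbs X B N \<and> pre_rkbs \<Omega> B' N' \<and> adjoint_reproducing X B N \<Omega> B' N' P K"

subsection \<open>The integral function spaces\<close>

definition A_op ::
    "'a::topological_space set \<Rightarrow> 'b::topological_space set \<Rightarrow> ('a \<times> 'b \<Rightarrow> real) \<Rightarrow>
     ('b set \<Rightarrow> real) \<Rightarrow> 'a \<Rightarrow> real" where
  "A_op X \<Omega> \<phi> \<mu> = (\<lambda>x. if x \<in> X then signed_integral \<Omega> \<mu> (\<lambda>w. \<phi> (x, w)) else 0)"

definition A_adj ::
    "'a::topological_space set \<Rightarrow> 'b::topological_space set \<Rightarrow> ('a \<times> 'b \<Rightarrow> real) \<Rightarrow>
     ('a set \<Rightarrow> real) \<Rightarrow> 'b \<Rightarrow> real" where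
  "A_adj X \<Omega> \<phi> \<rho> = (\<lambda>w. if w \<in> \<Omega> then signed_integral X \<rho> (\<lambda>x. \<phi> (x, w)) else 0)"

definition F_space ::
    "'a::topological_space set \<Rightarrow> 'b::topological_space set \<Rightarrow> ('a \<times> 'b \<Rightarrow> real) \<Rightarrow>
     ('a \<Rightarrow> real) set" where
  "F_space X \<Omega> \<phi> = {f. \<exists>\<mu>\<in>Meas \<Omega>. f = A_op X \<Omega> \<phi> \<mu>}"

definition F_norm ::
    "'a::topological_space set \<Rightarrow> 'b::topological_space set \<Rightarrow> ('a \<times> 'b \<Rightarrow> real) \<Rightarrow>
     ('a \<Rightarrow> real) \<Rightarrow> real" where
  "F_norm X \<Omega> \<phi> f = Inf {tv_norm \<Omega> \<mu> | \<mu>. \<mu> \<in> Meas \<Omega> \<and> f = A_op X \<Omega> \<phi> \<mu>}"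

definition G_space ::
    "'a::topological_space set \<Rightarrow> 'b::topological_space set \<Rightarrow> ('a \<times> 'b \<Rightarrow> real) \<Rightarrow>
     ('b \<Rightarrow> real) set" where
  "G_space X \<Omega> \<phi> = {g \<in> C0 \<Omega>. \<exists>\<rho>\<in>Meas X. A_adj X \<Omega> \<phi> \<rho> = g}"

definition FG_pairing ::
    "'a::topological_space set \<Rightarrow> 'b::topological_space set \<Rightarrow> ('a \<times> 'b \<Rightarrow> real) \<Rightarrow>
     ('a \<Rightarrow> real) \<Rightarrow> ('b \<Rightarrow> real) \<Rightarrow> real" where
  "FG_pairing X \<Omega> \<phi> f g = (THE c. \<exists>\<mu>\<in>Meas \<Omega>. \<exists>\<rho>\<in>Meas X.
     f = A_op X \<Omega> \<phi> \<mu> \<and> g = A_adj X \<Omega> \<phi> \<rho> \<and>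
     c = signed_integral (X \<times> \<Omega>) (signed_prod X \<Omega> \<rho> \<mu>) \<phi>)"

text \<open>
  With the supremum norm, \<open>G_space\<close> need not be complete. For example let \<open>X = \<Omega>\<close> be the set of
  natural numbers and let \<open>\<phi> (m, n)\<close> be \<open>1 / (n + 1)\<close> if \<open>m = n\<close> and \<open>0\<close> otherwise. Then
  \<open>G_space\<close> consists of the \<open>g\<close> for which the sum of all \<open>(n + 1) * \<bar>g n\<bar>\<close> is finite; it
  contains all finitely supported \<open>g\<close>, but not their uniform limit \<open>g n = 1 / (n + 1)\<close>.
  Its completion is its closure in \<open>C0 \<Omega>\<close>, again a space of functions on \<open>\<Omega>\<close>.
\<close>

definition G_completion ::
    "'a::topological_space set \<Rightarrow> 'b::topological_space set \<Rightarrow> ('a \<times> 'b \<Rightarrow> real) \<Rightarrow>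
     ('b \<Rightarrow> real) set" where
  "G_completion X \<Omega> \<phi> =
     {g \<in> C0 \<Omega>. \<forall>\<epsilon>>0. \<exists>h\<in>G_space X \<Omega> \<phi>. sup_norm \<Omega> (\<lambda>w. g w - h w) < \<epsilon>}"

end

theory Submission
  imports Defs "HOL-Probability.Giry_Monad"
begin

text \<open>
  By the Hahn decomposition every signed measure on \<open>S\<close> is a difference of two finite measures, and
  on a closed subset of a Polish space finite Borel measures are regular, so \<open>Meas S\<close> consists of all
  signed measures. It is complete for the total variation norm, hence its quotient \<open>F_space\<close> is
  complete.

  By Fubini's theorem the pairing of \<open>f = A \<mu>\<close> and \<open>g = A' \<rho>\<close> is both the integral of \<open>g\<close> against \<open>\<mu>\<close>
  and the integral of \<open>f\<close> against \<open>\<rho>\<close>, so it depends on \<open>f\<close> and \<open>g\<close> only. The first form extends to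
  uniform limits \<open>g\<close> of elements of \<open>G_space\<close> and gives \<open>\<bar>P f g\<bar> \<le> N f * sup_norm \<Omega> g\<close>. Conversely, the Dirac
  measure at \<open>w\<close> represents \<open>\<phi> (-, w)\<close>, which therefore has norm at most \<open>1\<close> and pairs with \<open>g\<close> to \<open>g w\<close>;
  so the embedding of \<open>G_space\<close> into the dual is isometric. Dirac measures give both
  reproducing identities.
\<close>

subsection \<open>Hahn decomposition\<close>

text \<open>Two obstacles shape the proof. First, \<open>pos_variation\<close> and
  \<open>neg_variation\<close> are not additive in the measure, so neither linearity of
  \<open>signed_integral\<close> in the measure nor Fubini's theorem for \<open>signed_prod\<close>
  follows term by term from the definitions. Both are instances of one principle: a linear relation
  between finite measures that holds on all Borel sets also holds between their integrals of a
  bounded Borel function (\<open>sum_list_integral_eq_0\<close>).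

  Second, \<open>A\<close> need not be injective, so a functional on \<open>F\<close> given through
  a representing measure must be shown not to depend on it. A limit \<open>g\<close> of elements of
  \<open>G\<close> need not come from any \<open>\<rho>\<close>; there, two measures with the same
  image under \<open>A\<close> integrate every approximant of \<open>g\<close> to the same value,
  and their finite total variation turns uniform closeness into closeness of integrals.

  Since the statement concerns both \<open>G\<close> and its closure, the embedding and the
  reproducing identities are proved for an arbitrary linear space between \<open>G\<close> and
  \<open>C0 \<Omega>\<close> on which pairing with \<open>A \<mu>\<close> is integration against
  \<open>\<mu>\<close>.\<close>

lemma sigma_algebra_borel_sets_on: "sigma_algebra S (borel_sets_on S)"
  using sets.sigma_algebra_axioms[of "restrict_space borel S"] by (simp add: space_restrict_space)

lemma top_in_borel_sets_on: "S \<in> borel_sets_on S"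
  using sets.top[of "restrict_space borel S"] by (simp add: space_restrict_space)

lemma borel_sets_on_subset: "E \<in> borel_sets_on S \<Longrightarrow> E \<subseteq> S"
  using sets.sets_into_space[of E "restrict_space borel S"] by (simp add: space_restrict_space)

context
  fixes S :: "'a::topological_space set" and \<mu>
  assumes \<mu>: "signed_measure_on S \<mu>"
begin

lemma signed_measure_outside: "E \<notin> borel_sets_on S \<Longrightarrow> \<mu> E = 0"
  using \<mu> by (simp add: signed_measure_on_def)

lemma signed_measure_sums:
  "range B \<subseteq> borel_sets_on S \<Longrightarrow> disjoint_family B \<Longrightarrow> (\<lambda>i::nat. \<mu> (B i)) sums \<mu> (\<Union>i. B i)"
  using \<mu> by (simp add: signed_measure_on_def)

lemma signed_measure_empty: "\<mu> {} = 0"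
proof -
  \<comment> \<open>Countable additivity for the constant sequence of empty sets: a constant series
    is summable only if its term is \<open>0\<close>.\<close>
  have "(\<lambda>i::nat. \<mu> {}) sums \<mu> (\<Union>i::nat. {})"
    by (rule signed_measure_sums) (auto simp: disjoint_family_on_def)
  then show ?thesis
    using sums_summable summable_const_iff by blast
qed

lemma signed_measure_Un:
  assumes "E \<in> borel_sets_on S" "F \<in> borel_sets_on S" "E \<inter> F = {}"
  shows "\<mu> (E \<union> F) = \<mu> E + \<mu> F"
proof -
  have "(\<lambda>i. \<mu> (binaryset E F i)) sums \<mu> (\<Union>i. binaryset E F i)"
    using assms by (intro signed_measure_sums) (auto simp: range_binaryset_eq disjoint_family_on_def binaryset_def)
  moreover have "(\<lambda>i. \<mu> (binaryset E F i)) sums (\<mu> E + \<mu> F)"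
    by (intro binaryset_sums signed_measure_empty)
  ultimately show ?thesis
    using sums_unique2 by (auto simp: UN_binaryset_eq)
qed

lemma signed_measure_Diff:
  assumes "E \<in> borel_sets_on S" "F \<in> borel_sets_on S" "F \<subseteq> E"
  shows "\<mu> (E - F) = \<mu> E - \<mu> F"
proof -
  have "\<mu> (F \<union> (E - F)) = \<mu> F + \<mu> (E - F)"
    using assms by (intro signed_measure_Un) auto
  moreover have "F \<union> (E - F) = E" using assms by auto
  ultimately show ?thesis by simp
qed

lemma signed_measure_inter_diff:
  assumes "E \<in> borel_sets_on S" "F \<in> borel_sets_on S"
  shows "\<mu> E = \<mu> (E \<inter> F) + \<mu> (E - F)"
proof -
  have "E \<inter> F \<union> (E - F) = E" by blast
  then show ?thesis
    using signed_measure_Un[of "E \<inter> F" "E - F"] assms by auto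
qed

lemma signed_measure_UN_incseq:
  assumes A: "range A \<subseteq> borel_sets_on S" and "incseq A"
  shows "(\<lambda>n. \<mu> (A n)) \<longlonglongrightarrow> \<mu> (\<Union>n. A n)"
proof -
  have D: "range (disjointed A) \<subseteq> borel_sets_on S"
    using A by (rule sets.range_disjointed_sets)
  have "(\<Sum>i<Suc n. \<mu> (disjointed A i)) = \<mu> (A n)" for n
  proof (induction n)
    case 0 show ?case by simp
  next
    case (Suc n)
    have "\<mu> (A (Suc n) - A n) = \<mu> (A (Suc n)) - \<mu> (A n)"
      using A \<open>incseq A\<close> by (intro signed_measure_Diff) (auto simp: incseq_Suc_iff)
    with Suc show ?case using \<open>incseq A\<close> by (simp add: disjointed_mono)
  qed
  moreover have "(\<lambda>i. \<mu> (disjointed A i)) sums \<mu> (\<Union>n. disjointed A n)"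
    by (rule signed_measure_sums[OF D disjoint_family_disjointed])
  ultimately show ?thesis
    by (simp add: sums_def UN_disjointed_eq LIMSEQ_lessThan_iff_atMost lessThan_Suc_atMost)
qed

lemma signed_measure_INT_decseq:
  assumes A: "range A \<subseteq> borel_sets_on S" and "decseq A"
  shows "(\<lambda>n. \<mu> (A n)) \<longlonglongrightarrow> \<mu> (\<Inter>n. A n)"
proof -
  \<comment> \<open>As \<open>\<mu>\<close> takes only finite values, complements in
    \<open>A 0\<close> reduce this to the increasing case.\<close>
  have "(\<lambda>n. \<mu> (A 0 - A n)) \<longlonglongrightarrow> \<mu> (\<Union>n. A 0 - A n)"
    using A \<open>decseq A\<close> by (intro signed_measure_UN_incseq) (auto simp: decseq_def incseq_def)
  moreover have "\<mu> (A 0 - A n) = \<mu> (A 0) - \<mu> (A n)" for n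
    using A \<open>decseq A\<close> by (intro signed_measure_Diff) (auto simp: decseq_def)
  moreover have "(\<Union>n. A 0 - A n) = A 0 - (\<Inter>n. A n)" by auto
  moreover have "\<mu> (A 0 - (\<Inter>n. A n)) = \<mu> (A 0) - \<mu> (\<Inter>n. A n)"
    using A by (intro signed_measure_Diff) auto
  ultimately have "(\<lambda>n. \<mu> (A 0) - \<mu> (A n)) \<longlonglongrightarrow> \<mu> (A 0) - \<mu> (\<Inter>n. A n)" by simp
  from tendsto_diff[OF tendsto_const[of "\<mu> (A 0)"] this] show ?thesis by simp
qed

text \<open>
  Keep removing subsets of measure below \<open>- \<epsilon>\<close>; they are disjoint, so by countable additivity
  their measures would tend to \<open>0\<close> if this never stopped.
\<close>

lemma almost_positive_subset:
  assumes D: "D \<in> borel_sets_on S" and "\<epsilon> > 0"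
  shows "\<exists>P\<in>borel_sets_on S. P \<subseteq> D \<and> \<mu> D \<le> \<mu> P \<and>
    (\<forall>E\<in>borel_sets_on S. E \<subseteq> P \<longrightarrow> - \<epsilon> \<le> \<mu> E)"
proof (rule ccontr)
  assume neg: "\<not> ?thesis"
  \<comment> \<open>\<open>Q\<close> survives each removal: taking away a set of negative measure
    raises \<open>\<mu>\<close>, so the lower bound \<open>\<mu> D\<close> is kept and, by
    \<open>neg\<close>, a further set to remove always exists.\<close>
  define Q where "Q P \<longleftrightarrow> P \<in> borel_sets_on S \<and> P \<subseteq> D \<and> \<mu> D \<le> \<mu> P" for P
  have "\<exists>E\<in>borel_sets_on S. E \<subseteq> P \<and> \<mu> E < - \<epsilon>" if "Q P" for P
    using neg that unfolding Q_def by (meson not_le)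
  then obtain F where F: "\<And>P. Q P \<Longrightarrow> F P \<in> borel_sets_on S \<and> F P \<subseteq> P \<and> \<mu> (F P) < - \<epsilon>"
    by metis
  define R where "R n = ((\<lambda>P. P - F P) ^^ n) D" for n
  have R_Suc: "R (Suc n) = R n - F (R n)" for n by (simp add: R_def)
  have Q: "Q (R n)" for n
  proof (induction n)
    case 0 then show ?case using D by (simp add: R_def Q_def)
  next
    case (Suc n)
    have "\<mu> (R n - F (R n)) = \<mu> (R n) - \<mu> (F (R n))"
      using F[OF Suc] Suc by (intro signed_measure_Diff) (auto simp: Q_def)
    with F[OF Suc] Suc \<open>\<epsilon> > 0\<close> show ?case by (auto simp: Q_def R_Suc)
  qed
  have dec: "decseq R" by (auto simp: decseq_Suc_iff R_Suc)
  have disj: "F (R m) \<inter> F (R n) = {}" if "m < n" for m n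
  proof -
    have "F (R n) \<subseteq> R (Suc m)"
      using F[OF Q, of n] decseqD[OF dec Suc_leI[OF that]] by blast
    then show ?thesis by (auto simp: R_Suc)
  qed
  have "disjoint_family (\<lambda>n. F (R n))"
    unfolding disjoint_family_on_def
    by (metis disj inf_commute linorder_neqE_nat)
  then have "(\<lambda>n. \<mu> (F (R n))) sums \<mu> (\<Union>n. F (R n))"
    using F[OF Q] by (intro signed_measure_sums) auto
  then have "(\<lambda>n. \<mu> (F (R n))) \<longlonglongrightarrow> 0"
    by (blast intro: summable_LIMSEQ_zero sums_summable)
  then have "0 \<le> - \<epsilon>"
    by (rule LIMSEQ_le_const2) (use F[OF Q] less_imp_le in blast)
  with \<open>\<epsilon> > 0\<close> show False by simp
qed

definition positive_set :: "'a set \<Rightarrow> bool" where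
  "positive_set P \<longleftrightarrow> P \<in> borel_sets_on S \<and> (\<forall>E\<in>borel_sets_on S. E \<subseteq> P \<longrightarrow> 0 \<le> \<mu> E)"

text \<open>Iterate \<open>almost_positive_subset\<close> with tolerances
  \<open>1 / (n + 1)\<close>, each time inside the previous set. The lower bound
  \<open>\<mu> D\<close> is kept along the chain, so continuity from above gives it to the
  intersection, whose subsets satisfy all the tolerances at once.\<close>

lemma positive_subset:
  assumes D: "D \<in> borel_sets_on S"
  shows "\<exists>P. positive_set P \<and> \<mu> D \<le> \<mu> P"
proof -
  define Q where "Q n P \<longleftrightarrow> P \<in> borel_sets_on S \<and> \<mu> D \<le> \<mu> P \<and>
    (\<forall>E\<in>borel_sets_on S. E \<subseteq> P \<longrightarrow> - inverse (real (Suc n)) \<le> \<mu> E)" for n P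
  have "\<exists>f. \<forall>n. Q n (f n) \<and> f (Suc n) \<subseteq> f n"
  proof (rule dependent_nat_choice)
    show "\<exists>P. Q 0 P" using almost_positive_subset[OF D, of 1] by (auto simp: Q_def)
    fix P n assume "Q n P"
    then show "\<exists>P'. Q (Suc n) P' \<and> P' \<subseteq> P"
      using almost_positive_subset[of P "inverse (real (Suc (Suc n)))"] unfolding Q_def
      by (smt (verit) inverse_positive_iff_positive of_nat_0_less_iff zero_less_Suc)
  qed
  then obtain f where f: "\<And>n. Q n (f n)" "\<And>n. f (Suc n) \<subseteq> f n" by blast
  have fS: "range f \<subseteq> borel_sets_on S" using f(1) by (auto simp: Q_def)
  have lim: "(\<lambda>n. \<mu> (f n)) \<longlonglongrightarrow> \<mu> (\<Inter>n. f n)"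
    using f(2) fS by (intro signed_measure_INT_decseq) (auto simp: decseq_Suc_iff)
  have "\<mu> D \<le> \<mu> (\<Inter>n. f n)"
    by (rule LIMSEQ_le_const[OF lim]) (use f(1) in \<open>auto simp: Q_def\<close>)
  moreover have "0 \<le> \<mu> E" if "E \<in> borel_sets_on S" "E \<subseteq> (\<Inter>n. f n)" for E
  proof -
    have "- inverse (real (Suc n)) \<le> \<mu> E" for n
      using f(1)[of n] that unfolding Q_def by blast
    then have "- 0 \<le> \<mu> E"
      by (intro LIMSEQ_le_const2[OF tendsto_minus[OF LIMSEQ_inverse_real_of_nat]]) auto
    then show ?thesis by simp
  qed
  moreover have "(\<Inter>n. f n) \<in> borel_sets_on S" using fS by blast
  ultimately show ?thesis unfolding positive_set_def by blast
qed

text \<open>A Borel subset of the union is cut along \<open>disjointed P\<close>: each piece lies in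
  a single \<open>P n\<close>, so countable additivity sums nonnegative terms. The comparison with
  \<open>P m\<close> follows because the remainder of the union is such a subset.\<close>

lemma positive_set_UN:
  assumes "\<And>n::nat. positive_set (P n)"
  shows "positive_set (\<Union>n. P n)" "\<mu> (P m) \<le> \<mu> (\<Union>n. P n)"
proof -
  have PS: "range P \<subseteq> borel_sets_on S" using assms by (auto simp: positive_set_def)
  have nonneg: "0 \<le> \<mu> E" if E: "E \<in> borel_sets_on S" "E \<subseteq> (\<Union>n. P n)" for E
  proof -
    have "range (\<lambda>n. E \<inter> disjointed P n) \<subseteq> borel_sets_on S"
      using sets.range_disjointed_sets[OF PS] E by blast
    then have *: "(\<lambda>n. \<mu> (E \<inter> disjointed P n)) sums \<mu> (\<Union>n. E \<inter> disjointed P n)"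
      using disjoint_family_disjointed[of P]
      by (intro signed_measure_sums) (auto simp: disjoint_family_on_def)
    have "(\<Union>n. E \<inter> disjointed P n) = E"
      using E(2) by (simp flip: Int_UN_distrib add: UN_disjointed_eq Int_absorb2)
    moreover have "0 \<le> \<mu> (E \<inter> disjointed P n)" for n
      using assms[of n] E sets.range_disjointed_sets[OF PS] disjointed_subset[of P n]
      unfolding positive_set_def by (metis (no_types, lifting) inf.coboundedI2 rangeI sets.Int subsetD)
    ultimately show ?thesis using sums_le[OF _ sums_zero *] by simp
  qed
  have U: "(\<Union>n. P n) \<in> borel_sets_on S" using PS by blast
  then show "positive_set (\<Union>n. P n)" using nonneg by (simp add: positive_set_def)
  have "\<mu> ((\<Union>n. P n) - P m) = \<mu> (\<Union>n. P n) - \<mu> (P m)"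
    using PS U by (intro signed_measure_Diff) auto
  moreover have "0 \<le> \<mu> ((\<Union>n. P n) - P m)" using PS U by (intro nonneg) auto
  ultimately show "\<mu> (P m) \<le> \<mu> (\<Union>n. P n)" by simp
qed

text \<open>\<open>H\<close> is a positive set of maximal measure \<open>s\<close>, built as a union
  of positive sets whose measures approach \<open>s\<close>. A set of positive measure disjoint from
  \<open>H\<close> could be added to \<open>H\<close> and would exceed \<open>s\<close>.\<close>

lemma Hahn_decomposition:
  obtains H where "H \<in> borel_sets_on S"
    "\<And>E. E \<in> borel_sets_on S \<Longrightarrow> E \<subseteq> H \<Longrightarrow> 0 \<le> \<mu> E"
    "\<And>E. E \<in> borel_sets_on S \<Longrightarrow> E \<inter> H = {} \<Longrightarrow> \<mu> E \<le> 0"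
proof -
  \<comment> \<open>If \<open>\<mu>\<close> were unbounded above, there would be positive sets of
    measure at least \<open>n\<close> for all \<open>n\<close>, and the real number that
    \<open>\<mu>\<close> assigns to their union would be at least every \<open>n\<close>.\<close>
  have bdd: "bdd_above (\<mu> ` borel_sets_on S)"
  proof (rule ccontr)
    assume "\<not> ?thesis"
    then have "\<exists>D\<in>borel_sets_on S. real n \<le> \<mu> D" for n
      by (metis (mono_tags, lifting) bdd_above.I2 linear)
    then have "\<exists>P. positive_set P \<and> real n \<le> \<mu> P" for n
      using positive_subset by (meson order_trans)
    then obtain P where "\<And>n. positive_set (P n)" "\<And>n. real n \<le> \<mu> (P n)" by metis
    then have "real n \<le> \<mu> (\<Union>n. P n)" for n
      using positive_set_UN(2)[of P n] by (meson order_trans)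
    then show False by (meson not_le reals_Archimedean2)
  qed
  define s where "s = Sup (\<mu> ` borel_sets_on S)"
  have "\<exists>P. positive_set P \<and> s - inverse (real (Suc n)) \<le> \<mu> P" for n
  proof -
    have "s - inverse (real (Suc n)) < s" by simp
    then obtain D where "D \<in> borel_sets_on S" "s - inverse (real (Suc n)) < \<mu> D"
      unfolding s_def using less_cSupD[of "\<mu> ` borel_sets_on S"] top_in_borel_sets_on[of S] by blast
    then show ?thesis using positive_subset[of D] by force
  qed
  then obtain P where P: "\<And>n. positive_set (P n)" "\<And>n. s - inverse (real (Suc n)) \<le> \<mu> (P n)"
    by metis
  define H where "H = (\<Union>n. P n)"
  have H: "positive_set H" unfolding H_def using P(1) by (rule positive_set_UN(1))
  have "s - inverse (real (Suc n)) \<le> \<mu> H" for n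
    using P(2)[of n] positive_set_UN(2)[of P n, OF P(1)] unfolding H_def by linarith
  then have "s - 0 \<le> \<mu> H"
    by (intro LIMSEQ_le_const2[OF tendsto_diff[OF tendsto_const LIMSEQ_inverse_real_of_nat]]) auto
  then have sH: "s \<le> \<mu> H" by simp
  have "\<mu> E \<le> 0" if E: "E \<in> borel_sets_on S" "E \<inter> H = {}" for E
  proof -
    have HS: "H \<in> borel_sets_on S" using H by (simp add: positive_set_def)
    have "\<mu> (E \<union> H) = \<mu> E + \<mu> H" using E HS by (intro signed_measure_Un) auto
    moreover have "\<mu> (E \<union> H) \<le> s"
      unfolding s_def using E HS by (intro cSup_upper bdd) auto
    ultimately show ?thesis using sH by simp
  qed
  with H show ?thesis using that unfolding positive_set_def by blast
qed

end

subsection \<open>Total variation and regularity\<close>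

lemma signed_measure_on_measure:
  assumes "finite_measure M" "sets M = borel_sets_on S"
  shows "signed_measure_on S (measure M)"
  unfolding signed_measure_on_def
  using assms(2) finite_measure.finite_measure_UNION[OF assms(1)]
  by (simp add: measure_notin_sets)

lemma signed_measure_on_add:
  "signed_measure_on S \<mu> \<Longrightarrow> signed_measure_on S \<nu> \<Longrightarrow> signed_measure_on S (\<lambda>E. \<mu> E + \<nu> E)"
  unfolding signed_measure_on_def by (simp add: sums_add)

lemma signed_measure_on_cmult:
  "signed_measure_on S \<mu> \<Longrightarrow> signed_measure_on S (\<lambda>E. c * \<mu> E)"
  unfolding signed_measure_on_def by (simp add: sums_mult)

lemma signed_measure_on_diff:
  "signed_measure_on S \<mu> \<Longrightarrow> signed_measure_on S \<nu> \<Longrightarrow> signed_measure_on S (\<lambda>E. \<mu> E - \<nu> E)"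
  unfolding signed_measure_on_def by (simp add: sums_diff)

lemma signed_measure_on_Int:
  assumes \<mu>: "signed_measure_on S \<mu>" and H: "H \<in> borel_sets_on S"
  shows "signed_measure_on S (\<lambda>E. if E \<in> borel_sets_on S then \<mu> (E \<inter> H) else 0)"
  unfolding signed_measure_on_def
proof (intro conjI allI impI)
  fix B :: "nat \<Rightarrow> 'a set"
  assume B: "range B \<subseteq> borel_sets_on S" "disjoint_family B"
  then have "(\<lambda>i. \<mu> (B i \<inter> H)) sums \<mu> (\<Union>i. B i \<inter> H)"
    using H by (intro signed_measure_sums[OF \<mu>]) (auto simp: disjoint_family_on_def)
  moreover have "B i \<in> borel_sets_on S" for i using B by auto
  moreover have "(\<Union>i. B i) \<in> borel_sets_on S" using B by blast
  ultimately show "(\<lambda>i. if B i \<in> borel_sets_on S then \<mu> (B i \<inter> H) else 0) sums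
      (if (\<Union>i. B i) \<in> borel_sets_on S then \<mu> ((\<Union>i. B i) \<inter> H) else 0)"
    by simp
qed simp

text \<open>The three variations are all \<open>measure_of\<close> applied to some formula. As soon
  as the formula agrees on Borel sets with a nonnegative signed measure, everything about the
  resulting measure follows. \<open>f\<close> and \<open>M\<close> are kept as variables so that the
  defining equations can be plugged in directly.\<close>

lemma nonneg_signed_measure:
  assumes \<nu>: "signed_measure_on S \<nu>" and nn: "\<And>E. E \<in> borel_sets_on S \<Longrightarrow> 0 \<le> \<nu> E"
    and f: "\<And>E. E \<in> borel_sets_on S \<Longrightarrow> f E = ennreal (\<nu> E)"
    and M: "M = measure_of S (borel_sets_on S) f"
  shows "sets M = borel_sets_on S" "space M = S" "finite_measure M"
    "E \<in> borel_sets_on S \<Longrightarrow> emeasure M E = ennreal (\<nu> E)"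
    "E \<in> borel_sets_on S \<Longrightarrow> measure M E = \<nu> E"
proof -
  interpret sigma_algebra S "borel_sets_on S" by (rule sigma_algebra_borel_sets_on)
  have M': "M = measure_of S (borel_sets_on S) (\<lambda>E. ennreal (\<nu> E))"
    unfolding M by (rule measure_of_eq) (auto simp: f sigma_sets_eq space_closed)
  show sets: "sets M = borel_sets_on S" and sp: "space M = S"
    by (simp_all add: M' sigma_sets_eq space_closed)
  have "countably_additive (borel_sets_on S) (\<lambda>E. ennreal (\<nu> E))"
  proof (rule countably_additiveI)
    fix B :: "nat \<Rightarrow> 'a set" assume B: "range B \<subseteq> borel_sets_on S" "disjoint_family B"
    have "B i \<in> borel_sets_on S" for i using B(1) by auto
    then show "(\<Sum>i. ennreal (\<nu> (B i))) = ennreal (\<nu> (\<Union>i. B i))"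
      by (rule suminf_ennreal_eq[OF nn signed_measure_sums[OF \<nu> B]])
  qed
  moreover have "positive (borel_sets_on S) (\<lambda>E. ennreal (\<nu> E))"
    by (simp add: positive_def signed_measure_empty[OF \<nu>])
  ultimately have em: "emeasure M E = ennreal (\<nu> E)" if "E \<in> borel_sets_on S" for E
    unfolding M' by (intro emeasure_measure_of_sigma[OF sigma_algebra_axioms _ _ that])
  then show "emeasure M E = ennreal (\<nu> E)" if "E \<in> borel_sets_on S" using that by simp
  show "measure M E = \<nu> E" if "E \<in> borel_sets_on S" for E
    using that nn em by (simp add: measure_def)
  show "finite_measure M"
    by (rule finite_measureI) (simp add: sp em top_in_borel_sets_on)
qed

text \<open>A Hahn set makes the variations explicit. The supremum over partitions is bounded by the
  triangle inequality, since \<open>\<mu> = p - n\<close> with \<open>p\<close> and \<open>n\<close>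
  nonnegative and countably additive, and it is attained by splitting along
  \<open>H\<close>.\<close>

lemma Jordan_decomposition:
  assumes \<mu>: "signed_measure_on S \<mu>"
  obtains H where "H \<in> borel_sets_on S"
    "\<And>E. E \<in> borel_sets_on S \<Longrightarrow> measure (total_variation S \<mu>) E = \<mu> (E \<inter> H) - \<mu> (E - H)"
    "\<And>E. E \<in> borel_sets_on S \<Longrightarrow> measure (pos_variation S \<mu>) E = \<mu> (E \<inter> H)"
    "\<And>E. E \<in> borel_sets_on S \<Longrightarrow> measure (neg_variation S \<mu>) E = - \<mu> (E - H)"
    "finite_measure (total_variation S \<mu>)" "finite_measure (pos_variation S \<mu>)"
    "finite_measure (neg_variation S \<mu>)"
    "sets (total_variation S \<mu>) = borel_sets_on S" "sets (pos_variation S \<mu>) = borel_sets_on S"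
    "sets (neg_variation S \<mu>) = borel_sets_on S"
proof -
  obtain H where H: "H \<in> borel_sets_on S"
    and pos: "\<And>E. E \<in> borel_sets_on S \<Longrightarrow> 0 \<le> \<mu> (E \<inter> H)"
    and neg: "\<And>E. E \<in> borel_sets_on S \<Longrightarrow> \<mu> (E - H) \<le> 0"
    by (rule Hahn_decomposition[OF \<mu>]) (smt (verit) Diff_disjoint Int_commute Int_lower2 sets.Diff sets.Int)
  define p where "p E = (if E \<in> borel_sets_on S then \<mu> (E \<inter> H) else 0)" for E
  \<comment> \<open>Defined as a difference, \<open>n\<close> is a signed measure at once; its
    formula in terms of \<open>H\<close> is derived afterwards.\<close>
  define n where "n E = p E - \<mu> E" for E
  have sp: "signed_measure_on S p"
    unfolding p_def by (rule signed_measure_on_Int[OF \<mu> H])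
  have sn: "signed_measure_on S n"
    unfolding n_def by (rule signed_measure_on_diff[OF sp \<mu>])
  have n: "n E = - \<mu> (E - H)" if "E \<in> borel_sets_on S" for E
    using signed_measure_inter_diff[OF \<mu> that H] that by (simp add: n_def p_def)
  have st: "signed_measure_on S (\<lambda>E. p E + n E)"
    by (rule signed_measure_on_add[OF sp sn])
  have p0: "0 \<le> p E" and n0: "0 \<le> n E" if "E \<in> borel_sets_on S" for E
    using that pos neg by (auto simp: n p_def)
  have t0: "0 \<le> p E + n E" if "E \<in> borel_sets_on S" for E
    using that p0 n0 by simp
  have tv: "(SUP B\<in>{B::nat \<Rightarrow> 'a set. range B \<subseteq> borel_sets_on S \<and> disjoint_family B \<and> (\<Union>i. B i) = E}.
            (\<Sum>i. ennreal \<bar>\<mu> (B i)\<bar>)) = ennreal (p E + n E)" if E: "E \<in> borel_sets_on S" for E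
  proof (rule antisym)
    show "(SUP B\<in>{B::nat \<Rightarrow> 'a set. range B \<subseteq> borel_sets_on S \<and> disjoint_family B \<and> (\<Union>i. B i) = E}.
            (\<Sum>i. ennreal \<bar>\<mu> (B i)\<bar>)) \<le> ennreal (p E + n E)"
    proof (rule SUP_least, safe)
      fix B :: "nat \<Rightarrow> 'a set"
      assume B: "range B \<subseteq> borel_sets_on S" "disjoint_family B" and E: "E = (\<Union>i. B i)"
      have "(\<Sum>i. ennreal (p (B i) + n (B i))) = ennreal (p (\<Union>i. B i) + n (\<Union>i. B i))"
        using B t0 by (intro suminf_ennreal_eq signed_measure_sums[OF st]) auto
      moreover have "\<bar>\<mu> (B i)\<bar> \<le> p (B i) + n (B i)" for i
        using p0[of "B i"] n0[of "B i"] B by (auto simp: n_def image_subset_iff)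
      ultimately show "(\<Sum>i. ennreal \<bar>\<mu> (B i)\<bar>) \<le> ennreal (p (\<Union>i. B i) + n (\<Union>i. B i))"
        by (metis (no_types, lifting) ennreal_leI suminf_le summableI)
    qed
  next
    \<comment> \<open>The extremal partition has the two blocks \<open>E \<inter> H\<close> and
      \<open>E - H\<close>, padded with empty sets.\<close>
    have "(\<Sum>i. ennreal \<bar>\<mu> (binaryset (E \<inter> H) (E - H) i)\<bar>) = ennreal (\<bar>\<mu> (E \<inter> H)\<bar> + \<bar>\<mu> (E - H)\<bar>)"
      by (intro suminf_ennreal_eq binaryset_sums[where f="\<lambda>A. \<bar>\<mu> A\<bar>"]) (auto simp: signed_measure_empty[OF \<mu>])
    also have "\<dots> = ennreal (p E + n E)" using E pos neg by (simp add: n p_def)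
    finally show "ennreal (p E + n E) \<le>
      (SUP B\<in>{B::nat \<Rightarrow> 'a set. range B \<subseteq> borel_sets_on S \<and> disjoint_family B \<and> (\<Union>i. B i) = E}.
            (\<Sum>i. ennreal \<bar>\<mu> (B i)\<bar>))"
      using E H by (intro SUP_upper2[of "binaryset (E \<inter> H) (E - H)"])
        (auto simp: range_binaryset_eq UN_binaryset_eq disjoint_family_on_def binaryset_def)
  qed
  note T = nonneg_signed_measure[OF st t0 tv total_variation_def]
  \<comment> \<open>With total variation \<open>p + n\<close> and \<open>\<mu> = p - n\<close>, the
    halves in the definitions of \<open>pos_variation\<close> and \<open>neg_variation\<close>
    collapse to \<open>p\<close> and \<open>n\<close>.\<close>
  have P_eq: "ennreal ((measure (total_variation S \<mu>) E + \<mu> E) / 2) = ennreal (p E)"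
    if "E \<in> borel_sets_on S" for E
    using that by (simp add: T(5) n_def)
  note P = nonneg_signed_measure[OF sp p0 P_eq pos_variation_def]
  have N_eq: "ennreal ((measure (total_variation S \<mu>) E - \<mu> E) / 2) = ennreal (n E)"
    if "E \<in> borel_sets_on S" for E
    using that by (simp add: T(5) n_def diff_divide_distrib)
  note N = nonneg_signed_measure[OF sn n0 N_eq neg_variation_def]
  show ?thesis
    by (rule that[OF H]) (simp_all add: T P N, simp_all add: n p_def)
qed

context
  fixes S :: "'a::topological_space set" and \<mu>
  assumes \<mu>: "signed_measure_on S \<mu>"
begin

lemma finite_total_variation: "finite_measure (total_variation S \<mu>)"
  and finite_pos_variation: "finite_measure (pos_variation S \<mu>)"
  and finite_neg_variation: "finite_measure (neg_variation S \<mu>)"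
  and sets_total_variation: "sets (total_variation S \<mu>) = borel_sets_on S"
  and sets_pos_variation: "sets (pos_variation S \<mu>) = borel_sets_on S"
  and sets_neg_variation: "sets (neg_variation S \<mu>) = borel_sets_on S"
  by (rule Jordan_decomposition[OF \<mu>], assumption)+

lemma space_total_variation: "space (total_variation S \<mu>) = S"
  and space_pos_variation: "space (pos_variation S \<mu>) = S"
  and space_neg_variation: "space (neg_variation S \<mu>) = S"
  using sets_total_variation sets_pos_variation sets_neg_variation
  by (auto dest!: sets_eq_imp_space_eq simp: space_restrict_space)

lemma pos_minus_neg_variation:
  "\<mu> E = measure (pos_variation S \<mu>) E - measure (neg_variation S \<mu>) E"
proof (cases "E \<in> borel_sets_on S")
  case True
  then show ?thesis
    by - (rule Jordan_decomposition[OF \<mu>], simp add: signed_measure_inter_diff[OF \<mu>, symmetric])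
next
  case False
  then show ?thesis
    by (simp add: signed_measure_outside[OF \<mu>] measure_notin_sets sets_pos_variation sets_neg_variation)
qed

lemma tv_norm_eq_pos_plus_neg:
  "tv_norm S \<mu> = measure (pos_variation S \<mu>) S + measure (neg_variation S \<mu>) S"
  by (rule Jordan_decomposition[OF \<mu>]) (simp add: tv_norm_def top_in_borel_sets_on)

text \<open>Together with the converse bound \<open>abs_add_abs_Diff_le_tv_norm\<close> below, this
  reduces every estimate of a total variation to the values on one set and its complement; the
  supremum over partitions is not touched again.\<close>

lemma tv_norm_Hahn:
  obtains H where "H \<in> borel_sets_on S" "tv_norm S \<mu> = \<mu> H - \<mu> (S - H)"
proof (rule Jordan_decomposition[OF \<mu>])
  fix H assume H: "H \<in> borel_sets_on S"
    and "\<And>E. E \<in> borel_sets_on S \<Longrightarrow> measure (total_variation S \<mu>) E = \<mu> (E \<inter> H) - \<mu> (E - H)"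
  moreover have "S \<inter> H = H" using borel_sets_on_subset[OF H] by auto
  ultimately show thesis
    by (intro that[OF H]) (simp add: tv_norm_def top_in_borel_sets_on)
qed

lemma tv_norm_nonneg: "0 \<le> tv_norm S \<mu>"
  by (simp add: tv_norm_def)

lemma abs_add_abs_Diff_le_tv_norm:
  assumes E: "E \<in> borel_sets_on S"
  shows "\<bar>\<mu> E\<bar> + \<bar>\<mu> (S - E)\<bar> \<le> tv_norm S \<mu>"
proof -
  interpret P: finite_measure "pos_variation S \<mu>" by (rule finite_pos_variation)
  interpret N: finite_measure "neg_variation S \<mu>" by (rule finite_neg_variation)
  have "measure (pos_variation S \<mu>) (S - E) = measure (pos_variation S \<mu>) S - measure (pos_variation S \<mu>) E"
    "measure (neg_variation S \<mu>) (S - E) = measure (neg_variation S \<mu>) S - measure (neg_variation S \<mu>) E"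
    using E P.finite_measure_compl N.finite_measure_compl
    by (auto simp: sets_pos_variation sets_neg_variation space_pos_variation space_neg_variation)
  then show ?thesis
    using measure_nonneg[of "pos_variation S \<mu>" E] measure_nonneg[of "neg_variation S \<mu>" E]
      measure_nonneg[of "pos_variation S \<mu>" "S - E"] measure_nonneg[of "neg_variation S \<mu>" "S - E"]
    unfolding pos_minus_neg_variation[of E] pos_minus_neg_variation[of "S - E"] tv_norm_eq_pos_plus_neg
    by linarith
qed

end

section \<open>The total variation norm: norm inequalities and completeness\<close>

lemma tv_norm_add_le:
  assumes \<mu>: "signed_measure_on S \<mu>" and \<nu>: "signed_measure_on S \<nu>"
  shows "tv_norm S (\<lambda>E. \<mu> E + \<nu> E) \<le> tv_norm S \<mu> + tv_norm S \<nu>"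
proof -
  obtain H where H: "H \<in> borel_sets_on S"
    and "tv_norm S (\<lambda>E. \<mu> E + \<nu> E) = \<mu> H + \<nu> H - (\<mu> (S - H) + \<nu> (S - H))"
    by (rule tv_norm_Hahn[OF signed_measure_on_add[OF \<mu> \<nu>]])
  then show ?thesis
    using abs_add_abs_Diff_le_tv_norm[OF \<mu> H] abs_add_abs_Diff_le_tv_norm[OF \<nu> H] by linarith
qed

lemma tv_norm_cmult_le:
  assumes \<mu>: "signed_measure_on S \<mu>"
  shows "tv_norm S (\<lambda>E. c * \<mu> E) \<le> \<bar>c\<bar> * tv_norm S \<mu>"
proof -
  obtain H where H: "H \<in> borel_sets_on S"
    and tv: "tv_norm S (\<lambda>E. c * \<mu> E) = c * \<mu> H - c * \<mu> (S - H)"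
    by (rule tv_norm_Hahn[OF signed_measure_on_cmult[OF \<mu>]])
  note tv also have "\<dots> \<le> \<bar>c\<bar> * (\<bar>\<mu> H\<bar> + \<bar>\<mu> (S - H)\<bar>)"
    unfolding distrib_left abs_mult[symmetric] by linarith
  also have "\<dots> \<le> \<bar>c\<bar> * tv_norm S \<mu>"
    by (intro mult_left_mono abs_add_abs_Diff_le_tv_norm[OF \<mu> H]) simp
  finally show ?thesis .
qed

text \<open>A bound that is uniform in the set allows the limit and countable additivity to be
  interchanged. In the norm estimate a Hahn set of the difference and its complement each contribute
  one error \<open>r n\<close>, hence the factor \<open>2\<close>.\<close>

lemma signed_measure_uniform_limit:
  assumes \<nu>: "\<And>n. signed_measure_on S (\<nu> n)" and r: "r \<longlonglongrightarrow> 0"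
    and out: "\<And>E. E \<notin> borel_sets_on S \<Longrightarrow> \<mu> E = 0"
    and bnd: "\<And>n E. E \<in> borel_sets_on S \<Longrightarrow> \<bar>\<nu> n E - \<mu> E\<bar> \<le> r n"
  shows "signed_measure_on S \<mu>" "tv_norm S (\<lambda>E. \<nu> n E - \<mu> E) \<le> 2 * r n"
proof -
  have lim: "(\<lambda>n. \<nu> n E) \<longlonglongrightarrow> \<mu> E" if "E \<in> borel_sets_on S" for E
    using Lim_null_comparison[OF _ r, of "\<lambda>n. \<nu> n E - \<mu> E"] bnd[OF that] by (simp add: LIM_zero_iff)
  show sm: "signed_measure_on S \<mu>"
    unfolding signed_measure_on_def
  proof (intro conjI allI impI out)
    fix B :: "nat \<Rightarrow> 'a set"
    assume B: "range B \<subseteq> borel_sets_on S" "disjoint_family B"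
    define U where "U = (\<Union>i. B i)"
    have U: "U \<in> borel_sets_on S" using B unfolding U_def by blast
    \<comment> \<open>Finite additivity survives the setwise limit. Only convergence along the
      initial unions \<open>V\<close> needs uniformity, by going from \<open>\<mu> (V k)\<close> to
      \<open>\<nu> n (V k)\<close>, to \<open>\<nu> n U\<close> and to \<open>\<mu> U\<close> at a
      cost of \<open>e / 3\<close> each.\<close>
    define V where "V k = (\<Union>i<k. B i)" for k
    have V: "V k \<in> borel_sets_on S" for k using B unfolding V_def by (intro sets.finite_UN) auto
    have VSuc: "V (Suc k) = V k \<union> B k" for k by (auto simp: V_def less_Suc_eq)
    have "V k \<inter> B k = {}" for k
      using disjoint_family_onD[OF B(2), of _ k] unfolding V_def by fastforce
    then have "\<nu> n (V (Suc k)) = \<nu> n (V k) + \<nu> n (B k)" for n k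
      using B V unfolding VSuc by (intro signed_measure_Un[OF \<nu>]) auto
    then have fin\<nu>: "\<nu> n (V k) = (\<Sum>i<k. \<nu> n (B i))" for n k
      by (induction k) (auto simp: signed_measure_empty[OF \<nu>] V_def)
    have "(\<lambda>n. \<Sum>i<k. \<nu> n (B i)) \<longlonglongrightarrow> (\<Sum>i<k. \<mu> (B i))" for k
      using B by (intro tendsto_sum lim) auto
    then have fin: "\<mu> (V k) = (\<Sum>i<k. \<mu> (B i))" for k
      using lim[OF V, of k] LIMSEQ_unique unfolding fin\<nu> by blast
    have "(\<lambda>k. \<mu> (V k)) \<longlonglongrightarrow> \<mu> U"
    proof (rule LIMSEQ_I)
      fix e :: real assume "e > 0"
      then obtain n where n: "r n < e / 3"
        using order_tendstoD(2)[OF r, of "e / 3"] by (auto simp: eventually_sequentially)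
      have "(\<lambda>k. \<nu> n (V k)) \<longlonglongrightarrow> \<nu> n U"
        using signed_measure_sums[OF \<nu> B] unfolding fin\<nu> U_def sums_def .
      from LIMSEQ_D[OF this, of "e / 3"] \<open>e > 0\<close>
      obtain K where K: "\<And>k. k \<ge> K \<Longrightarrow> \<bar>\<nu> n (V k) - \<nu> n U\<bar> < e / 3"
        unfolding real_norm_def by auto
      have "\<bar>\<mu> (V k) - \<mu> U\<bar> < e" if "k \<ge> K" for k
        using K[OF that] bnd[OF V, of n k] bnd[OF U, of n] n by linarith
      then show "\<exists>K. \<forall>k\<ge>K. norm (\<mu> (V k) - \<mu> U) < e" by auto
    qed
    then show "(\<lambda>i. \<mu> (B i)) sums \<mu> (\<Union>i. B i)" unfolding fin U_def sums_def .
  qed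
  obtain H where H: "H \<in> borel_sets_on S"
    and "tv_norm S (\<lambda>E. \<nu> n E - \<mu> E) = \<nu> n H - \<mu> H - (\<nu> n (S - H) - \<mu> (S - H))"
    by (rule tv_norm_Hahn[OF signed_measure_on_diff[OF \<nu> sm]])
  moreover have "S - H \<in> borel_sets_on S"
    using H top_in_borel_sets_on[of S] by blast
  ultimately show "tv_norm S (\<lambda>E. \<nu> n E - \<mu> E) \<le> 2 * r n"
    using bnd[OF H, of n] bnd[of "S - H" n] by linarith
qed

text \<open>Regularity on the whole space is applied to the push-forward \<open>M\<close> of the
  total variation under the inclusion of \<open>S\<close>. Closedness of \<open>S\<close> makes
  Borel sets of \<open>S\<close> Borel in the whole space; relatively open sets are traces of open
  ones, and on compact subsets of \<open>S\<close> the two measures agree.\<close>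

lemma Meas_closed:
  fixes S :: "'a::{second_countable_topology, complete_space} set"
  assumes S: "closed S"
  shows "Meas S = {\<mu>. signed_measure_on S \<mu>}"
proof -
  have "regular_on S (total_variation S \<mu>)" if \<mu>: "signed_measure_on S \<mu>" for \<mu>
  proof -
    define T where "T = total_variation S \<mu>"
    interpret T: finite_measure T unfolding T_def by (rule finite_total_variation[OF \<mu>])
    have sT: "sets T = borel_sets_on S" unfolding T_def by (rule sets_total_variation[OF \<mu>])
    have spT: "space T = S" unfolding T_def by (rule space_total_variation[OF \<mu>])
    have meas: "id \<in> measurable T borel"
      unfolding measurable_cong_sets[OF sT refl] by (intro measurable_restrict_space1) simp
    define M where "M = distr T borel id"
    have M: "emeasure M A = emeasure T (A \<inter> S)" if "A \<in> sets borel" for A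
      unfolding M_def using that by (simp add: emeasure_distr[OF meas] spT)
    have sM: "sets M = sets borel" and fM: "emeasure M (space M) \<noteq> \<infinity>"
      by (auto simp: M_def emeasure_distr[OF meas])
    have SB: "S \<in> sets borel" using S by (simp add: borel_closed)
    show ?thesis unfolding regular_on_def T_def[symmetric]
    proof (intro ballI conjI)
      fix E assume E: "E \<in> borel_sets_on S"
      then have EB: "E \<in> sets borel" and ES: "E \<subseteq> S"
        using SB borel_sets_on_subset[OF E] by (auto simp: sets_restrict_space)
      have TE: "emeasure T E = emeasure M E" using M[OF EB] ES by (simp add: Int_absorb2)
      show "emeasure T E = (INF V\<in>{V. E \<subseteq> V \<and> openin (top_of_set S) V}. emeasure T V)"
      proof (rule antisym)
        show "emeasure T E \<le> (INF V\<in>{V. E \<subseteq> V \<and> openin (top_of_set S) V}. emeasure T V)"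
        proof (rule INF_greatest, safe)
          fix V assume V: "E \<subseteq> V" "openin (top_of_set S) V"
          then have "V \<in> sets T" unfolding sT by (auto simp: openin_open sets_restrict_space)
          with V show "emeasure T E \<le> emeasure T V" by (intro emeasure_mono)
        qed
        show "(INF V\<in>{V. E \<subseteq> V \<and> openin (top_of_set S) V}. emeasure T V) \<le> emeasure T E"
          unfolding TE outer_regular[OF sM fM EB]
        proof (rule INF_mono, safe)
          fix U :: "'a set" assume U: "E \<subseteq> U" "open U"
          then show "\<exists>V\<in>{V. E \<subseteq> V \<and> openin (top_of_set S) V}. emeasure T V \<le> emeasure M U"
            using ES by (intro bexI[of _ "U \<inter> S"]) (auto simp: M openin_open)
        qed
      qed
      have "emeasure M K = emeasure T K" if "K \<subseteq> E" "compact K" for K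
        using that ES M[of K] by (simp add: borel_compact Int_absorb2)
      then show "emeasure T E = (SUP K\<in>{K. K \<subseteq> E \<and> compact K}. emeasure T K)"
        unfolding TE inner_regular[OF sM fM EB] by (intro SUP_cong) auto
    qed
  qed
  then show ?thesis by (auto simp: Meas_def)
qed

subsection \<open>Integration against signed measures\<close>

text \<open>The class of integrands: it contains \<open>C0 S\<close> and is closed under linear
  combinations, and each member is integrable for every finite Borel measure on \<open>S\<close>, so
  integrability need not be tracked measure by measure.\<close>

definition bounded_borel_on :: "'a::topological_space set \<Rightarrow> ('a \<Rightarrow> real) \<Rightarrow> bool" where
  "bounded_borel_on S f \<longleftrightarrow>
     f \<in> borel_measurable (restrict_space borel S) \<and> (\<exists>C. \<forall>x\<in>S. \<bar>f x\<bar> \<le> C)"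

lemma bounded_borel_on_add:
  assumes "bounded_borel_on S f" "bounded_borel_on S g"
  shows "bounded_borel_on S (\<lambda>x. f x + g x)"
proof -
  obtain C D where "\<And>x. x \<in> S \<Longrightarrow> \<bar>f x\<bar> \<le> C" "\<And>x. x \<in> S \<Longrightarrow> \<bar>g x\<bar> \<le> D"
    using assms unfolding bounded_borel_on_def by blast
  then have "\<forall>x\<in>S. \<bar>f x + g x\<bar> \<le> C + D" by (meson abs_triangle_ineq add_mono order_trans)
  with assms show ?thesis unfolding bounded_borel_on_def by (auto intro: borel_measurable_add)
qed

lemma bounded_borel_on_cmult:
  assumes "bounded_borel_on S f"
  shows "bounded_borel_on S (\<lambda>x. c * f x)"
proof -
  obtain C where "\<And>x. x \<in> S \<Longrightarrow> \<bar>f x\<bar> \<le> C"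
    using assms unfolding bounded_borel_on_def by blast
  then have "\<forall>x\<in>S. \<bar>c * f x\<bar> \<le> \<bar>c\<bar> * C" by (simp add: abs_mult mult_left_mono)
  with assms show ?thesis unfolding bounded_borel_on_def by (auto intro: borel_measurable_times)
qed

lemma bounded_borel_on_diff:
  "bounded_borel_on S f \<Longrightarrow> bounded_borel_on S g \<Longrightarrow> bounded_borel_on S (\<lambda>x. f x - g x)"
  using bounded_borel_on_add[OF _ bounded_borel_on_cmult[of S g "-1"], of f] by simp

definition finite_borel_measure_on :: "'a::topological_space set \<Rightarrow> 'a measure \<Rightarrow> bool" where
  "finite_borel_measure_on S M \<longleftrightarrow> finite_measure M \<and> sets M = borel_sets_on S"

lemma finite_borel_measure_on_variation:
  assumes "signed_measure_on S \<mu>"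
  shows "finite_borel_measure_on S (pos_variation S \<mu>)" "finite_borel_measure_on S (neg_variation S \<mu>)"
  using assms by (simp_all add: finite_borel_measure_on_def finite_pos_variation finite_neg_variation
    sets_pos_variation sets_neg_variation)

lemma space_finite_borel_measure_on: "finite_borel_measure_on S M \<Longrightarrow> space M = S"
  using sets_eq_imp_space_eq[of M "restrict_space borel S"]
  by (simp add: space_restrict_space finite_borel_measure_on_def)

lemma finite_borel_measure_on_measurable:
  "finite_borel_measure_on S M \<Longrightarrow>
    (borel_measurable M :: ('a::topological_space \<Rightarrow> real) set) = borel_measurable (restrict_space borel S)"
  unfolding finite_borel_measure_on_def by (intro measurable_cong_sets) auto

lemma integrable_bounded_borel_on:
  assumes M: "finite_borel_measure_on S M" and f: "bounded_borel_on S f"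
  shows "integrable M f"
proof -
  interpret finite_measure M using M by (simp add: finite_borel_measure_on_def)
  obtain C where "\<And>x. x \<in> S \<Longrightarrow> \<bar>f x\<bar> \<le> C" using f by (auto simp: bounded_borel_on_def)
  then have "AE x in M. norm (f x) \<le> C"
    by (intro AE_I2) (simp add: space_finite_borel_measure_on[OF M])
  moreover have "f \<in> borel_measurable M"
    using f finite_borel_measure_on_measurable[OF M] by (simp add: bounded_borel_on_def)
  ultimately show ?thesis by (rule integrable_const_bound)
qed

lemma abs_integral_le_bound:
  assumes M: "finite_borel_measure_on S M" and f: "bounded_borel_on S f"
    and C: "\<And>x. x \<in> S \<Longrightarrow> \<bar>f x\<bar> \<le> C"
  shows "\<bar>\<integral>x. f x \<partial>M\<bar> \<le> C * measure M S"
proof -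
  interpret finite_measure M using M by (simp add: finite_borel_measure_on_def)
  have sp: "space M = S" by (rule space_finite_borel_measure_on[OF M])
  have "\<bar>\<integral>x. f x \<partial>M\<bar> \<le> (\<integral>x. \<bar>f x\<bar> \<partial>M)" by (rule integral_abs_bound)
  also have "\<dots> \<le> (\<integral>x. C \<partial>M)"
    using integrable_bounded_borel_on[OF M f] C by (intro integral_mono) (auto simp: sp)
  finally show ?thesis by (simp add: sp mult.commute)
qed

text \<open>Stated for a list so that concrete relations between measures are read off by simplification.\<close>

lemma sum_list_integral_eq_0:
  assumes M: "\<And>c M. (c, M) \<in> set L \<Longrightarrow> finite_borel_measure_on S M"
    and 0: "\<And>E. E \<in> borel_sets_on S \<Longrightarrow> (\<Sum>(c, M)\<leftarrow>L. c * measure M E) = 0"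
    and f: "bounded_borel_on S f"
  shows "(\<Sum>(c, M)\<leftarrow>L. c * (\<integral>x. f x \<partial>M)) = 0"
proof -
  define Q where "Q u = (\<Sum>(c, M)\<leftarrow>L. c * (\<integral>x. u x \<partial>M))" for u :: "'a \<Rightarrow> real"
  let ?R = "restrict_space borel S"
  have Q_cong: "Q u = Q v" if "\<And>x. x \<in> S \<Longrightarrow> u x = v x" for u v
    unfolding Q_def using that
    by (intro arg_cong[where f=sum_list] map_cong refl)
      (auto intro!: Bochner_Integration.integral_cong simp: space_finite_borel_measure_on[OF M])
  have Q_add: "Q (\<lambda>x. u x + v x) = Q u + Q v" if "bounded_borel_on S u" "bounded_borel_on S v" for u v
  proof -
    have "map (\<lambda>(c, M). c * (\<integral>x. u x + v x \<partial>M)) L =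
        map (\<lambda>p. (case p of (c, M) \<Rightarrow> c * (\<integral>x. u x \<partial>M)) + (case p of (c, M) \<Rightarrow> c * (\<integral>x. v x \<partial>M))) L"
      using integrable_bounded_borel_on[OF M that(1)] integrable_bounded_borel_on[OF M that(2)]
      by (intro map_cong refl) (auto simp: distrib_left)
    then show ?thesis unfolding Q_def by (simp only: sum_list_addf)
  qed
  have Q_cmult: "Q (\<lambda>x. a * u x) = a * Q u" for a u
    unfolding Q_def by (simp add: sum_list_const_mult[symmetric] case_prod_unfold mult.left_commute)
  have Q_ind: "Q (indicator A) = 0" if "A \<in> borel_sets_on S" for A
  proof -
    have "A \<inter> space M = A" if "(c, M) \<in> set L" for c M
      using \<open>A \<in> _\<close> borel_sets_on_subset[of A S] space_finite_borel_measure_on[OF M[OF that]] by auto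
    then have eq: "map (\<lambda>(c, M). c * (\<integral>x. indicator A x \<partial>M)) L = map (\<lambda>(c, M). c * measure M A) L"
      by (intro map_cong refl) auto
    show ?thesis unfolding Q_def by (simp only: eq 0[OF that])
  qed
  have Q_lim: "(\<lambda>i. Q (U i)) \<longlonglongrightarrow> Q u"
    if U: "\<And>i. U i \<in> borel_measurable ?R" "\<And>i x. x \<in> S \<Longrightarrow> \<bar>U i x\<bar> \<le> C"
      and u: "u \<in> borel_measurable ?R" and lim: "\<And>x. x \<in> S \<Longrightarrow> (\<lambda>i. U i x) \<longlonglongrightarrow> u x" for U u C
  proof -
    have "(\<lambda>i. \<integral>x. U i x \<partial>M) \<longlonglongrightarrow> (\<integral>x. u x \<partial>M)" if "(c, M) \<in> set L" for c M
    proof (rule integral_dominated_convergence[where w="\<lambda>_. C"])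
      note fb = M[OF that]
      interpret finite_measure M using fb by (simp add: finite_borel_measure_on_def)
      show "u \<in> borel_measurable M" "\<And>i. U i \<in> borel_measurable M" "integrable M (\<lambda>_. C)"
        using U u finite_borel_measure_on_measurable[OF fb] by auto
      show "AE x in M. (\<lambda>i. U i x) \<longlonglongrightarrow> u x" "\<And>i. AE x in M. norm (U i x) \<le> C"
        using lim U by (auto intro!: AE_I2 simp: space_finite_borel_measure_on[OF fb])
    qed
    then show ?thesis unfolding Q_def
      by (induction L) (auto intro!: tendsto_add tendsto_mult)
  qed
  have nonneg: "Q u = 0" if u: "u \<in> borel_measurable ?R" and u0: "\<And>x. 0 \<le> u x"
    and C: "\<And>x. x \<in> S \<Longrightarrow> u x \<le> C" for u C
    \<comment> \<open>\<open>C\<close> is generalised because the induction passes to scaled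
      functions with other bounds. In the monotone limit it is the dominating constant.\<close>
    using u u0 C
  proof (induction arbitrary: C rule: borel_measurable_induct_real)
    case (set A C)
    then show ?case by (intro Q_ind)
  next
    case (mult u c C)
    show ?case
    proof (cases "c = 0")
      case False
      then have "c > 0" using mult by simp
      have "u x \<le> C / c" if "x \<in> S" for x
        using mult.prems[OF that] \<open>c > 0\<close> by (simp add: field_simps)
      then have "Q u = 0" using mult.IH by blast
      then show ?thesis by (simp add: Q_cmult)
    qed (simp add: Q_cmult[of 0 "\<lambda>_. 0", simplified])
  next
    case (add u v C)
    have le: "u x \<le> C" "v x \<le> C" if "x \<in> S" for x
      using add.prems[OF that] add.hyps(2)[of x] add.hyps(4)[of x] by linarith+
    then have "Q u = 0" "Q v = 0" using add.IH by blast+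
    moreover have "bounded_borel_on S u" "bounded_borel_on S v"
      unfolding bounded_borel_on_def using add.hyps le by (auto intro!: exI[of _ C])
    ultimately show ?case by (simp add: Q_add)
  next
    case (seq U C)
    have mono: "U i x \<le> u x" if "x \<in> S" for i x
      using that seq.hyps(3,4) by (intro incseq_le) (simp_all add: incseq_def le_fun_def space_restrict_space)
    have "(\<lambda>i. Q (U i)) \<longlonglongrightarrow> Q u"
    proof (rule Q_lim)
      show "\<bar>U i x\<bar> \<le> C" if "x \<in> S" for i x
        using seq.hyps(2)[of i x] mono[OF that, of i] seq.prems[OF that] by simp
    qed (use seq.hyps u in \<open>auto simp: space_restrict_space\<close>)
    moreover have "Q (U i) = 0" for i
      by (rule seq.IH) (use mono seq.prems order_trans in blast)
    ultimately show ?case by (simp add: LIMSEQ_const_iff)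
  qed
  obtain C where C: "\<And>x. x \<in> S \<Longrightarrow> \<bar>f x\<bar> \<le> C" using f by (auto simp: bounded_borel_on_def)
  have fm: "f \<in> borel_measurable ?R" using f by (simp add: bounded_borel_on_def)
  \<comment> \<open>Adding \<open>D\<close> makes \<open>f\<close> nonnegative on \<open>S\<close>.
    The \<open>max\<close> with \<open>0\<close> below does so off \<open>S\<close>, where nothing
    bounds \<open>f\<close>, since the induction is for functions that are nonnegative everywhere.
    Taking \<open>max C 0\<close> keeps \<open>D\<close> nonnegative even for empty
    \<open>S\<close>.\<close>
  define D where "D = max C 0"
  have fD: "0 \<le> f x + D \<and> f x + D \<le> 2 * D" if "x \<in> S" for x
    using C[OF that] unfolding D_def by linarith
  have "Q (\<lambda>x. max 0 (f x + D)) = 0"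
  proof (rule nonneg)
    show "(\<lambda>x. max 0 (f x + D)) \<in> borel_measurable ?R"
      by (intro borel_measurable_max borel_measurable_add borel_measurable_const fm)
    show "max 0 (f x + D) \<le> 2 * D" if "x \<in> S" for x
      using fD[OF that] by simp
  qed simp
  moreover have "Q (\<lambda>x. max 0 (f x + D)) = Q (\<lambda>x. f x + D)"
    using fD by (intro Q_cong) simp
  moreover have "Q (\<lambda>x. f x + D) = Q f + Q (\<lambda>_. D)"
    by (intro Q_add f) (auto simp: bounded_borel_on_def)
  moreover have "Q (\<lambda>_. D) = 0"
    by (intro nonneg[where C=D]) (auto simp: D_def)
  ultimately show ?thesis by (simp add: Q_def)
qed

text \<open>Any representation of \<open>\<mu>\<close> as a linear combination of finite measures
  computes its integral, not only the Jordan decomposition: move the latter to the other side and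
  apply \<open>sum_list_integral_eq_0\<close>. Sums, multiples and products of signed measures come
  with such representations, whose relation to the Jordan decomposition is never examined.\<close>

lemma signed_integral_eqI:
  assumes \<mu>: "signed_measure_on S \<mu>" and f: "bounded_borel_on S f"
    and M: "\<And>c M. (c, M) \<in> set L \<Longrightarrow> finite_borel_measure_on S M"
    and eq: "\<And>E. E \<in> borel_sets_on S \<Longrightarrow> \<mu> E = (\<Sum>(c, M)\<leftarrow>L. c * measure M E)"
  shows "signed_integral S \<mu> f = (\<Sum>(c, M)\<leftarrow>L. c * (\<integral>x. f x \<partial>M))"
proof -
  let ?L = "(-1, pos_variation S \<mu>) # (1, neg_variation S \<mu>) # L"
  have "(\<Sum>(c, M)\<leftarrow>?L. c * (\<integral>x. f x \<partial>M)) = 0"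
    using M finite_borel_measure_on_variation[OF \<mu>] eq
    by (intro sum_list_integral_eq_0[OF _ _ f]) (auto simp: pos_minus_neg_variation[OF \<mu>] algebra_simps)
  then show ?thesis by (simp add: signed_integral_def)
qed

lemma signed_integral_measure:
  assumes "finite_borel_measure_on S M" "bounded_borel_on S f"
  shows "signed_integral S (measure M) f = (\<integral>x. f x \<partial>M)"
  using signed_integral_eqI[OF signed_measure_on_measure assms(2), of M "[(1, M)]"] assms
  by (auto simp: finite_borel_measure_on_def)

lemma signed_integral_add_measure:
  assumes "signed_measure_on S \<mu>" "signed_measure_on S \<nu>" "bounded_borel_on S f"
  shows "signed_integral S (\<lambda>E. \<mu> E + \<nu> E) f = signed_integral S \<mu> f + signed_integral S \<nu> f"
proof -
  have "signed_integral S (\<lambda>E. \<mu> E + \<nu> E) f = (\<Sum>(c, M)\<leftarrow>[(1, pos_variation S \<mu>),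
      (-1, neg_variation S \<mu>), (1, pos_variation S \<nu>), (-1, neg_variation S \<nu>)]. c * (\<integral>x. f x \<partial>M))"
    using assms finite_borel_measure_on_variation
    by (intro signed_integral_eqI[OF signed_measure_on_add[OF assms(1,2)]])
      (auto simp: pos_minus_neg_variation)
  then show ?thesis by (simp add: signed_integral_def)
qed

lemma signed_integral_cmult_measure:
  assumes "signed_measure_on S \<mu>" "bounded_borel_on S f"
  shows "signed_integral S (\<lambda>E. c * \<mu> E) f = c * signed_integral S \<mu> f"
proof -
  have "signed_integral S (\<lambda>E. c * \<mu> E) f = (\<Sum>(c, M)\<leftarrow>[(c, pos_variation S \<mu>),
      (-c, neg_variation S \<mu>)]. c * (\<integral>x. f x \<partial>M))"
    using assms finite_borel_measure_on_variation
    by (intro signed_integral_eqI[OF signed_measure_on_cmult[OF assms(1)]])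
      (auto simp: pos_minus_neg_variation[OF assms(1)] algebra_simps)
  then show ?thesis by (simp add: signed_integral_def algebra_simps)
qed

lemma signed_integral_add:
  assumes "signed_measure_on S \<mu>" "bounded_borel_on S f" "bounded_borel_on S g"
  shows "signed_integral S \<mu> (\<lambda>x. f x + g x) = signed_integral S \<mu> f + signed_integral S \<mu> g"
  using assms finite_borel_measure_on_variation[OF assms(1)]
  by (simp add: signed_integral_def integrable_bounded_borel_on)

lemma signed_integral_cmult:
  "signed_integral S \<mu> (\<lambda>x. c * f x) = c * signed_integral S \<mu> f"
  by (simp add: signed_integral_def algebra_simps)

lemma signed_integral_cong:
  assumes "signed_measure_on S \<mu>" "\<And>x. x \<in> S \<Longrightarrow> f x = g x"
  shows "signed_integral S \<mu> f = signed_integral S \<mu> g"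
  unfolding signed_integral_def using assms
  by (intro arg_cong2[where f="(-)"] Bochner_Integration.integral_cong refl)
    (auto simp: space_pos_variation space_neg_variation)

lemma abs_signed_integral_le:
  assumes \<mu>: "signed_measure_on S \<mu>" and f: "bounded_borel_on S f"
    and C: "\<And>x. x \<in> S \<Longrightarrow> \<bar>f x\<bar> \<le> C"
  shows "\<bar>signed_integral S \<mu> f\<bar> \<le> C * tv_norm S \<mu>"
  using abs_integral_le_bound[OF finite_borel_measure_on_variation(1)[OF \<mu>] f C]
    abs_integral_le_bound[OF finite_borel_measure_on_variation(2)[OF \<mu>] f C]
  unfolding tv_norm_eq_pos_plus_neg[OF \<mu>] signed_integral_def distrib_left by linarith

section \<open>Point masses\<close>

definition dirac_on :: "'a::topological_space set \<Rightarrow> 'a \<Rightarrow> 'a set \<Rightarrow> real" where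
  "dirac_on S x = measure (return (restrict_space borel S) x)"

lemma
  assumes x: "x \<in> S"
  shows signed_measure_on_dirac: "signed_measure_on S (dirac_on S x)"
    and tv_norm_dirac: "tv_norm S (dirac_on S x) \<le> 1"
    and signed_integral_dirac: "bounded_borel_on S f \<Longrightarrow> signed_integral S (dirac_on S x) f = f x"
proof -
  let ?D = "return (restrict_space borel S) x"
  have D: "finite_borel_measure_on S ?D"
    using x prob_space_return[of x "restrict_space borel S"]
    by (auto simp: finite_borel_measure_on_def space_restrict_space prob_space.axioms)
  show s: "signed_measure_on S (dirac_on S x)"
    unfolding dirac_on_def using D by (intro signed_measure_on_measure) (auto simp: finite_borel_measure_on_def)
  obtain H where H: "H \<in> borel_sets_on S" "tv_norm S (dirac_on S x) = dirac_on S x H - dirac_on S x (S - H)"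
    by (rule tv_norm_Hahn[OF s])
  moreover have "dirac_on S x H \<le> 1" "0 \<le> dirac_on S x (S - H)"
    using H(1) by (simp_all add: dirac_on_def measure_return)
  ultimately show "tv_norm S (dirac_on S x) \<le> 1" by linarith
  show "signed_integral S (dirac_on S x) f = f x" if f: "bounded_borel_on S f"
    unfolding dirac_on_def signed_integral_measure[OF D f]
    using f x by (intro integral_return) (auto simp: bounded_borel_on_def space_restrict_space)
qed

subsection \<open>Functions vanishing at infinity and Fubini's theorem\<close>

lemma C0_outside: "f \<in> C0 S \<Longrightarrow> x \<notin> S \<Longrightarrow> f x = 0"
  by (simp add: C0_def)

lemma C0_vanishing:
  "f \<in> C0 S \<Longrightarrow> \<epsilon> > 0 \<Longrightarrow> \<exists>K\<subseteq>S. compact K \<and> (\<forall>x\<in>S - K. \<bar>f x\<bar> < \<epsilon>)"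
  by (simp add: C0_def)

lemma C0_continuous_on: "f \<in> C0 S \<Longrightarrow> continuous_on S f"
  by (simp add: C0_def)

lemma C0I:
  assumes "\<And>x. x \<notin> S \<Longrightarrow> f x = 0" "continuous_on S f"
    "\<And>\<epsilon>. \<epsilon> > 0 \<Longrightarrow> \<exists>K\<subseteq>S. compact K \<and> (\<forall>x\<in>S - K. \<bar>f x\<bar> < \<epsilon>)"
  shows "f \<in> C0 S"
  using assms unfolding C0_def by simp

lemma C0_bounded_borel_on:
  assumes f: "f \<in> C0 S"
  shows "bounded_borel_on S f"
proof -
  note cont = C0_continuous_on[OF f]
  obtain K where K: "K \<subseteq> S" "compact K" "\<And>x. x \<in> S - K \<Longrightarrow> \<bar>f x\<bar> < 1"
    using C0_vanishing[OF f zero_less_one] by blast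
  have "bounded (f ` K)"
    by (intro compact_imp_bounded compact_continuous_image continuous_on_subset[OF cont] K)
  then obtain C where C: "\<And>x. x \<in> K \<Longrightarrow> \<bar>f x\<bar> \<le> C" by (auto simp: bounded_iff)
  have "\<bar>f x\<bar> \<le> max C 1" if "x \<in> S" for x
    using C[of x] K(3)[of x] that by (cases "x \<in> K") auto
  then show ?thesis
    using borel_measurable_continuous_on_restrict[OF cont] by (auto simp: bounded_borel_on_def)
qed

lemma
  assumes f: "bounded_borel_on S f"
  shows abs_le_sup_norm: "x \<in> S \<Longrightarrow> \<bar>f x\<bar> \<le> sup_norm S f"
    and sup_norm_nonneg: "0 \<le> sup_norm S f"
proof -
  obtain C where C: "\<And>x. x \<in> S \<Longrightarrow> \<bar>f x\<bar> \<le> C" using f by (auto simp: bounded_borel_on_def)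
  have bdd: "bdd_above (insert 0 ((\<lambda>x. \<bar>f x\<bar>) ` S))"
    by (rule bdd_aboveI[of _ "max 0 C"]) (use C in force)
  show "x \<in> S \<Longrightarrow> \<bar>f x\<bar> \<le> sup_norm S f" "0 \<le> sup_norm S f"
    unfolding sup_norm_def by (rule cSup_upper[OF _ bdd]; simp)+
qed

lemma sup_norm_le:
  assumes "0 \<le> C" "\<And>x. x \<in> S \<Longrightarrow> \<bar>f x\<bar> \<le> C"
  shows "sup_norm S f \<le> C"
  unfolding sup_norm_def using assms by (intro cSup_least) auto

lemma C0_zero: "(\<lambda>x. 0) \<in> C0 S"
  by (auto simp: C0_def intro!: exI[of _ "{}"])

lemma C0_add:
  assumes f: "f \<in> C0 S" and g: "g \<in> C0 S"
  shows "(\<lambda>x. f x + g x) \<in> C0 S"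
proof -
  have "\<exists>K\<subseteq>S. compact K \<and> (\<forall>x\<in>S - K. \<bar>f x + g x\<bar> < \<epsilon>)" if "\<epsilon> > 0" for \<epsilon>
  proof -
    have "\<epsilon> / 2 > 0" using that by simp
    obtain K where K: "K \<subseteq> S" "compact K" "\<And>x. x \<in> S - K \<Longrightarrow> \<bar>f x\<bar> < \<epsilon> / 2"
      using C0_vanishing[OF f \<open>\<epsilon> / 2 > 0\<close>] by blast
    obtain L where L: "L \<subseteq> S" "compact L" "\<And>x. x \<in> S - L \<Longrightarrow> \<bar>g x\<bar> < \<epsilon> / 2"
      using C0_vanishing[OF g \<open>\<epsilon> / 2 > 0\<close>] by blast
    have "\<bar>f x + g x\<bar> < \<epsilon>" if "x \<in> S - (K \<union> L)" for x
    proof -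
      have "\<bar>f x\<bar> < \<epsilon> / 2" "\<bar>g x\<bar> < \<epsilon> / 2" using that K(3)[of x] L(3)[of x] by blast+
      then show ?thesis by linarith
    qed
    moreover have "K \<union> L \<subseteq> S" "compact (K \<union> L)" using K L by (simp_all add: compact_Un)
    ultimately show ?thesis by blast
  qed
  then show ?thesis
    using continuous_on_add[OF f[THEN C0_continuous_on] g[THEN C0_continuous_on]]
    by (intro C0I) (simp_all add: C0_outside[OF f] C0_outside[OF g])
qed

lemma C0_cmult:
  assumes f: "f \<in> C0 S"
  shows "(\<lambda>x. c * f x) \<in> C0 S"
proof -
  have "\<exists>K\<subseteq>S. compact K \<and> (\<forall>x\<in>S - K. \<bar>c * f x\<bar> < \<epsilon>)" if "\<epsilon> > 0" for \<epsilon>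
  proof -
    \<comment> \<open>The summand \<open>1\<close> covers \<open>c = 0\<close> without a case
      distinction.\<close>
    have "\<epsilon> / (\<bar>c\<bar> + 1) > 0" using that by simp
    from C0_vanishing[OF f this] obtain K
      where K: "K \<subseteq> S" "compact K" "\<forall>x\<in>S - K. \<bar>f x\<bar> < \<epsilon> / (\<bar>c\<bar> + 1)"
      by blast
    have "\<bar>c * f x\<bar> < \<epsilon>" if "x \<in> S - K" for x
    proof -
      have "\<bar>f x\<bar> * (\<bar>c\<bar> + 1) < \<epsilon>"
        using K(3) that by (simp add: pos_less_divide_eq)
      moreover have "\<bar>c * f x\<bar> = \<bar>f x\<bar> * (\<bar>c\<bar> + 1) - \<bar>f x\<bar>"
        by (simp add: abs_mult distrib_left)
      ultimately show ?thesis by linarith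
    qed
    with K(1,2) show ?thesis by blast
  qed
  then show ?thesis
    using continuous_on_mult_left[OF f[THEN C0_continuous_on], of c]
    by (intro C0I) (simp_all add: C0_outside[OF f])
qed

lemma C0_diff: "f \<in> C0 S \<Longrightarrow> g \<in> C0 S \<Longrightarrow> (\<lambda>x. f x - g x) \<in> C0 S"
  using C0_add[OF _ C0_cmult[of g S "-1"], of f] by simp

lemma C0_uniform_limit:
  assumes out: "\<And>x. x \<notin> S \<Longrightarrow> f x = 0"
    and approx: "\<And>\<epsilon>. \<epsilon> > 0 \<Longrightarrow> \<exists>g\<in>C0 S. \<forall>x\<in>S. \<bar>f x - g x\<bar> < \<epsilon>"
  shows "f \<in> C0 S"
proof -
  have "\<exists>g\<in>C0 S. \<forall>x\<in>S. \<bar>f x - g x\<bar> < inverse (real (Suc n))" for n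
    by (rule approx) simp
  then obtain g where g: "\<And>n. g n \<in> C0 S"
    and fg: "\<And>n x. x \<in> S \<Longrightarrow> \<bar>f x - g n x\<bar> < inverse (real (Suc n))"
    by metis
  have "uniform_limit S g f sequentially"
  proof (rule uniform_limitI)
    fix e :: real assume "e > 0"
    then have "\<forall>\<^sub>F n in sequentially. inverse (real (Suc n)) < e"
      using LIMSEQ_inverse_real_of_nat order_tendstoD(2) by blast
    then show "\<forall>\<^sub>F n in sequentially. \<forall>x\<in>S. dist (g n x) (f x) < e"
    proof eventually_elim
      case (elim n)
      have "dist (g n x) (f x) < e" if "x \<in> S" for x
        using fg[OF that, of n] elim by (simp only: dist_real_def abs_minus_commute)
      then show ?case by blast
    qed
  qed
  then have "continuous_on S f"
    by (rule uniform_limit_theorem[rotated]) (simp_all add: C0_continuous_on[OF g])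
  moreover have "\<exists>K\<subseteq>S. compact K \<and> (\<forall>x\<in>S - K. \<bar>f x\<bar> < \<epsilon>)" if "\<epsilon> > 0" for \<epsilon>
  proof -
    have "\<epsilon> / 2 > 0" using that by simp
    then obtain h where h: "h \<in> C0 S" "\<And>x. x \<in> S \<Longrightarrow> \<bar>f x - h x\<bar> < \<epsilon> / 2"
      using approx by blast
    obtain K where K: "K \<subseteq> S" "compact K" "\<And>x. x \<in> S - K \<Longrightarrow> \<bar>h x\<bar> < \<epsilon> / 2"
      using C0_vanishing[OF h(1) \<open>\<epsilon> / 2 > 0\<close>] by blast
    have "\<bar>f x\<bar> < \<epsilon>" if "x \<in> S - K" for x
    proof -
      have "\<bar>h x\<bar> < \<epsilon> / 2" "\<bar>f x - h x\<bar> < \<epsilon> / 2" using that K(3)[of x] h(2)[of x] by blast+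
      then show ?thesis by linarith
    qed
    with K show ?thesis by blast
  qed
  ultimately show ?thesis using out by (intro C0I)
qed

lemma C0_section:
  assumes \<phi>: "\<phi> \<in> C0 (X \<times> \<Omega>)"
  shows "x \<in> X \<Longrightarrow> (\<lambda>w. \<phi> (x, w)) \<in> C0 \<Omega>" "w \<in> \<Omega> \<Longrightarrow> (\<lambda>x. \<phi> (x, w)) \<in> C0 X"
proof -
  note cont = C0_continuous_on[OF \<phi>]
  show "(\<lambda>w. \<phi> (x, w)) \<in> C0 \<Omega>" if x: "x \<in> X"
  proof (rule C0I)
    show "continuous_on \<Omega> (\<lambda>w. \<phi> (x, w))"
      by (rule continuous_on_compose2[OF cont]) (use x in \<open>auto intro!: continuous_on_Pair\<close>)
    show "\<phi> (x, w) = 0" if "w \<notin> \<Omega>" for w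
      using that by (intro C0_outside[OF \<phi>]) simp
    fix \<epsilon> :: real assume "\<epsilon> > 0"
    then obtain K where K: "K \<subseteq> X \<times> \<Omega>" "compact K" "\<forall>z\<in>X \<times> \<Omega> - K. \<bar>\<phi> z\<bar> < \<epsilon>"
      using C0_vanishing[OF \<phi>] by blast
    have "compact (snd ` K)"
      by (intro compact_continuous_image continuous_on_snd continuous_on_id K)
    moreover have "\<bar>\<phi> (x, w)\<bar> < \<epsilon>" if "w \<in> \<Omega> - snd ` K" for w
      using that x K(3) imageI[of "(x, w)" K snd] by auto
    moreover have "snd ` K \<subseteq> \<Omega>" using K(1) by auto
    ultimately show "\<exists>K\<subseteq>\<Omega>. compact K \<and> (\<forall>w\<in>\<Omega> - K. \<bar>\<phi> (x, w)\<bar> < \<epsilon>)"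
      by blast
  qed
  show "(\<lambda>x. \<phi> (x, w)) \<in> C0 X" if w: "w \<in> \<Omega>"
  proof (rule C0I)
    show "continuous_on X (\<lambda>x. \<phi> (x, w))"
      by (rule continuous_on_compose2[OF cont]) (use w in \<open>auto intro!: continuous_on_Pair\<close>)
    show "\<phi> (x, w) = 0" if "x \<notin> X" for x
      using that by (intro C0_outside[OF \<phi>]) simp
    fix \<epsilon> :: real assume "\<epsilon> > 0"
    then obtain K where K: "K \<subseteq> X \<times> \<Omega>" "compact K" "\<forall>z\<in>X \<times> \<Omega> - K. \<bar>\<phi> z\<bar> < \<epsilon>"
      using C0_vanishing[OF \<phi>] by blast
    have "compact (fst ` K)"
      by (intro compact_continuous_image continuous_on_fst continuous_on_id K)
    moreover have "\<bar>\<phi> (x, w)\<bar> < \<epsilon>" if "x \<in> X - fst ` K" for x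
      using that w K(3) imageI[of "(x, w)" K fst] by auto
    moreover have "fst ` K \<subseteq> X" using K(1) by auto
    ultimately show "\<exists>K\<subseteq>X. compact K \<and> (\<forall>x\<in>X - K. \<bar>\<phi> (x, w)\<bar> < \<epsilon>)"
      by blast
  qed
qed

text \<open>\<open>signed_prod\<close> lives on the Borel sets of the product, whereas product
  measures and Fubini's theorem live on the product sigma-algebra. Second countability, through
  \<open>borel_prod\<close>, reconciles the two.\<close>

lemma sets_pair_restrict_borel:
  fixes X :: "'a::second_countable_topology set" and \<Omega> :: "'b::second_countable_topology set"
  shows "sets (restrict_space borel X \<Otimes>\<^sub>M restrict_space borel \<Omega>) = borel_sets_on (X \<times> \<Omega>)"
proof (rule antisym)
  let ?P = "restrict_space borel X \<Otimes>\<^sub>M restrict_space borel \<Omega>"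
  show "sets ?P \<subseteq> borel_sets_on (X \<times> \<Omega>)"
  proof (rule sets_pair_in_sets)
    fix a b assume "a \<in> borel_sets_on X" "b \<in> borel_sets_on \<Omega>"
    then obtain a' b' where ab: "a' \<in> sets borel" "b' \<in> sets borel" "a = X \<inter> a'" "b = \<Omega> \<inter> b'"
      by (auto simp: sets_restrict_space)
    then have "a' \<times> b' \<in> sets borel"
      unfolding borel_prod[symmetric] by (intro pair_measureI)
    moreover have "a \<times> b = (X \<times> \<Omega>) \<inter> (a' \<times> b')" using ab by auto
    ultimately show "a \<times> b \<in> borel_sets_on (X \<times> \<Omega>)"
      unfolding sets_restrict_space by blast
  qed
  \<comment> \<open>This is the inclusion into the unrestricted product, so a trace of a Borel set
    is the preimage of that set.\<close>
  have m: "(\<lambda>z. (fst z, snd z)) \<in> ?P \<rightarrow>\<^sub>M (borel \<Otimes>\<^sub>M borel)"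
    by (intro measurable_Pair measurable_compose[OF measurable_fst] measurable_compose[OF measurable_snd]
      measurable_restrict_space1) simp_all
  show "borel_sets_on (X \<times> \<Omega>) \<subseteq> sets ?P"
  proof
    fix E assume "E \<in> borel_sets_on (X \<times> \<Omega>)"
    then obtain E' where E': "E' \<in> sets (borel \<Otimes>\<^sub>M borel)" "E = (X \<times> \<Omega>) \<inter> E'"
      unfolding sets_restrict_space borel_prod by blast
    have "(\<lambda>z. (fst z, snd z)) -` E' \<inter> space ?P = E"
      using E' by (auto simp: space_pair_measure space_restrict_space)
    with measurable_sets[OF m E'(1)] show "E \<in> sets ?P" by simp
  qed
qed

lemma finite_borel_measure_on_pair:
  fixes X :: "'a::second_countable_topology set" and \<Omega> :: "'b::second_countable_topology set"
  assumes "finite_borel_measure_on X M" "finite_borel_measure_on \<Omega> N"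
  shows "finite_borel_measure_on (X \<times> \<Omega>) (M \<Otimes>\<^sub>M N)"
  using assms finite_measure_pair_measure[of N M] sets_pair_measure_cong[of M "restrict_space borel X" N "restrict_space borel \<Omega>"]
  by (auto simp: finite_borel_measure_on_def sets_pair_restrict_borel)

text \<open>\<open>signed_prod\<close> expands into four product measures. By
  \<open>signed_integral_eqI\<close> it may be integrated against each of them separately, without
  knowing the Jordan decomposition of the product, and Fubini's theorem is applied four times;
  indexing the variations by \<open>bool\<close> makes this one statement.\<close>

lemma signed_integral_signed_prod:
  fixes X :: "'a::second_countable_topology set" and \<Omega> :: "'b::second_countable_topology set"
  assumes \<rho>: "signed_measure_on X \<rho>" and \<mu>: "signed_measure_on \<Omega> \<mu>"
    and f: "bounded_borel_on (X \<times> \<Omega>) f"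
  shows "signed_integral (X \<times> \<Omega>) (signed_prod X \<Omega> \<rho> \<mu>) f
      = signed_integral X \<rho> (\<lambda>x. signed_integral \<Omega> \<mu> (\<lambda>w. f (x, w)))" (is ?fst)
    "signed_integral (X \<times> \<Omega>) (signed_prod X \<Omega> \<rho> \<mu>) f
      = signed_integral \<Omega> \<mu> (\<lambda>w. signed_integral X \<rho> (\<lambda>x. f (x, w)))" (is ?snd)
proof -
  define P where "P = (\<lambda>b. if b then pos_variation X \<rho> else neg_variation X \<rho>)"
  define Q where "Q = (\<lambda>b. if b then pos_variation \<Omega> \<mu> else neg_variation \<Omega> \<mu>)"
  have P: "finite_borel_measure_on X (P i)" and Q: "finite_borel_measure_on \<Omega> (Q i)" for i
    using finite_borel_measure_on_variation[OF \<rho>] finite_borel_measure_on_variation[OF \<mu>]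
    by (simp_all add: P_def Q_def)
  have PQ: "finite_borel_measure_on (X \<times> \<Omega>) (P i \<Otimes>\<^sub>M Q j)" for i j
    by (rule finite_borel_measure_on_pair[OF P Q])
  have prod: "signed_prod X \<Omega> \<rho> \<mu> = (\<lambda>E. measure (P True \<Otimes>\<^sub>M Q True) E + measure (P False \<Otimes>\<^sub>M Q False) E
     - measure (P True \<Otimes>\<^sub>M Q False) E - measure (P False \<Otimes>\<^sub>M Q True) E)"
  proof
    fix E
    show "signed_prod X \<Omega> \<rho> \<mu> E = measure (P True \<Otimes>\<^sub>M Q True) E + measure (P False \<Otimes>\<^sub>M Q False) E
     - measure (P True \<Otimes>\<^sub>M Q False) E - measure (P False \<Otimes>\<^sub>M Q True) E"
    proof (cases "E \<in> borel_sets_on (X \<times> \<Omega>)")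
      case True then show ?thesis by (simp add: signed_prod_def P_def Q_def)
    next
      case False
      then have "measure (P i \<Otimes>\<^sub>M Q j) E = 0" for i j
        using PQ[of i j] by (simp add: measure_notin_sets finite_borel_measure_on_def)
      with False show ?thesis by (simp add: signed_prod_def)
    qed
  qed
  have "signed_measure_on (X \<times> \<Omega>) (signed_prod X \<Omega> \<rho> \<mu>)"
    unfolding prod using PQ unfolding finite_borel_measure_on_def
    by (intro signed_measure_on_add signed_measure_on_diff signed_measure_on_measure) auto
  then have eq: "signed_integral (X \<times> \<Omega>) (signed_prod X \<Omega> \<rho> \<mu>) f =
      (\<Sum>(c, M)\<leftarrow>[(1, P True \<Otimes>\<^sub>M Q True), (1, P False \<Otimes>\<^sub>M Q False),
        (-1, P True \<Otimes>\<^sub>M Q False), (-1, P False \<Otimes>\<^sub>M Q True)]. c * (\<integral>z. f z \<partial>M))"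
    by (rule signed_integral_eqI[OF _ f]) (auto simp: PQ prod)
  have fubini: "integrable (P i) (\<lambda>x. \<integral>w. f (x, w) \<partial>Q j)" "integrable (Q j) (\<lambda>w. \<integral>x. f (x, w) \<partial>P i)"
    "(\<integral>x. (\<integral>w. f (x, w) \<partial>Q j) \<partial>P i) = (\<integral>z. f z \<partial>(P i \<Otimes>\<^sub>M Q j))"
    "(\<integral>w. (\<integral>x. f (x, w) \<partial>P i) \<partial>Q j) = (\<integral>z. f z \<partial>(P i \<Otimes>\<^sub>M Q j))" for i j
  proof -
    interpret Pi: finite_measure "P i" using P by (simp add: finite_borel_measure_on_def)
    interpret Qj: finite_measure "Q j" using Q by (simp add: finite_borel_measure_on_def)
    interpret pair_sigma_finite "P i" "Q j" ..
    have int: "integrable (P i \<Otimes>\<^sub>M Q j) (case_prod (\<lambda>x w. f (x, w)))"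
      using integrable_bounded_borel_on[OF PQ f] by simp
    show "integrable (P i) (\<lambda>x. \<integral>w. f (x, w) \<partial>Q j)" "integrable (Q j) (\<lambda>w. \<integral>x. f (x, w) \<partial>P i)"
      "(\<integral>x. (\<integral>w. f (x, w) \<partial>Q j) \<partial>P i) = (\<integral>z. f z \<partial>(P i \<Otimes>\<^sub>M Q j))"
      "(\<integral>w. (\<integral>x. f (x, w) \<partial>P i) \<partial>Q j) = (\<integral>z. f z \<partial>(P i \<Otimes>\<^sub>M Q j))"
      using integrable_fst[OF int] integrable_snd[OF int] integral_fst[OF int] integral_snd[OF int]
      by simp_all
  qed
  have sP: "signed_integral X \<rho> h = (\<integral>x. h x \<partial>P True) - (\<integral>x. h x \<partial>P False)" for h
    by (simp add: signed_integral_def P_def)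
  have sQ: "signed_integral \<Omega> \<mu> h = (\<integral>x. h x \<partial>Q True) - (\<integral>x. h x \<partial>Q False)" for h
    by (simp add: signed_integral_def Q_def)
  show ?fst ?snd
    unfolding eq sP sQ by (simp_all add: fubini)
qed

subsection \<open>The adjoint pair\<close>

text \<open>Homogeneity is asked for only as an inequality: applied to \<open>c * f\<close> with the
  factor \<open>1 / c\<close> it yields the reverse one. With \<open>c = 0\<close> it also gives the
  norm of the zero function.\<close>

lemma normed_fun_spaceI:
  assumes out: "\<And>f x. f \<in> B \<Longrightarrow> x \<notin> X \<Longrightarrow> f x = 0"
    and zero: "(\<lambda>x. 0) \<in> B"
    and add: "\<And>f g. f \<in> B \<Longrightarrow> g \<in> B \<Longrightarrow> (\<lambda>x. f x + g x) \<in> B"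
    and cmult: "\<And>c f. f \<in> B \<Longrightarrow> (\<lambda>x. c * f x) \<in> B"
    and nonneg: "\<And>f. f \<in> B \<Longrightarrow> 0 \<le> N f"
    and definite: "\<And>f x. f \<in> B \<Longrightarrow> N f = 0 \<Longrightarrow> x \<in> X \<Longrightarrow> f x = 0"
    and scale: "\<And>c f. f \<in> B \<Longrightarrow> N (\<lambda>x. c * f x) \<le> \<bar>c\<bar> * N f"
    and triangle: "\<And>f g. f \<in> B \<Longrightarrow> g \<in> B \<Longrightarrow> N (\<lambda>x. f x + g x) \<le> N f + N g"
  shows "normed_fun_space X B N"
proof -
  have N0: "N (\<lambda>x. 0) = 0"
    using scale[OF zero, of 0] nonneg[OF zero] by simp
  have homogeneous: "N (\<lambda>x. c * f x) = \<bar>c\<bar> * N f" if f: "f \<in> B" for c f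
  proof (cases "c = 0")
    case True
    then show ?thesis by (simp add: N0)
  next
    case False
    then have "N f \<le> \<bar>1 / c\<bar> * N (\<lambda>x. c * f x)"
      using scale[OF cmult[OF f, of c], of "1 / c"] by simp
    then have "\<bar>c\<bar> * N f \<le> N (\<lambda>x. c * f x)"
      using False by (simp add: pos_le_divide_eq mult.commute)
    then show ?thesis using scale[OF f, of c] by linarith
  qed
  have "f = (\<lambda>x. 0)" if "f \<in> B" "N f = 0" for f
    using that out definite by blast
  then have zero_iff: "N f = 0 \<longleftrightarrow> f = (\<lambda>x. 0)" if "f \<in> B" for f
    using that N0 by blast
  show ?thesis
    unfolding normed_fun_space_def
    by (intro conjI ballI allI impI; (rule zero add cmult nonneg homogeneous triangle zero_iff out; assumption))
qed

lemma normed_fun_space_sup_norm: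
  assumes B: "B \<subseteq> C0 \<Omega>" and zero: "(\<lambda>w. 0) \<in> B"
    and add: "\<And>f g. f \<in> B \<Longrightarrow> g \<in> B \<Longrightarrow> (\<lambda>w. f w + g w) \<in> B"
    and cmult: "\<And>c f. f \<in> B \<Longrightarrow> (\<lambda>w. c * f w) \<in> B"
  shows "normed_fun_space \<Omega> B (sup_norm \<Omega>)"
proof (rule normed_fun_spaceI[OF _ zero add cmult])
  have bb: "bounded_borel_on \<Omega> f" if "f \<in> B" for f
    using that B C0_bounded_borel_on by blast
  note le = abs_le_sup_norm[OF bb] and nonneg = sup_norm_nonneg[OF bb]
  show "f w = 0" if "f \<in> B" "w \<notin> \<Omega>" for f w
    using that B C0_outside by blast
  show "0 \<le> sup_norm \<Omega> f" if "f \<in> B" for f by (rule nonneg[OF that])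
  show "f w = 0" if "f \<in> B" "sup_norm \<Omega> f = 0" "w \<in> \<Omega>" for f w
    using le[OF that(1,3)] that(2) by simp
  show "sup_norm \<Omega> (\<lambda>w. c * f w) \<le> \<bar>c\<bar> * sup_norm \<Omega> f" if f: "f \<in> B" for c f
  proof (rule sup_norm_le)
    show "\<bar>c * f w\<bar> \<le> \<bar>c\<bar> * sup_norm \<Omega> f" if "w \<in> \<Omega>" for w
      unfolding abs_mult by (intro mult_left_mono le f that) simp
  qed (simp add: nonneg f)
  show "sup_norm \<Omega> (\<lambda>w. f w + g w) \<le> sup_norm \<Omega> f + sup_norm \<Omega> g" if f: "f \<in> B" and g: "g \<in> B" for f g
  proof (rule sup_norm_le)
    show "\<bar>f w + g w\<bar> \<le> sup_norm \<Omega> f + sup_norm \<Omega> g" if "w \<in> \<Omega>" for w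
      using le[OF f that] le[OF g that] by linarith
  qed (simp add: nonneg f g)
qed

lemma bounded_evaluations_sup_norm:
  "B \<subseteq> C0 \<Omega> \<Longrightarrow> bounded_evaluations \<Omega> B (sup_norm \<Omega>)"
  unfolding bounded_evaluations_def
  by (intro ballI exI[of _ 1]) (simp add: abs_le_sup_norm[OF C0_bounded_borel_on] subsetD)

locale integral_kernel =
  fixes X :: "'a::{second_countable_topology, complete_space} set"
    and \<Omega> :: "'b::{second_countable_topology, complete_space} set"
    and \<phi> :: "'a \<times> 'b \<Rightarrow> real"
  assumes X: "closed X" and \<Omega>: "closed \<Omega>" and \<phi>: "\<phi> \<in> C0 (X \<times> \<Omega>)"
begin

abbreviation "A \<equiv> A_op X \<Omega> \<phi>"
abbreviation "A' \<equiv> A_adj X \<Omega> \<phi>"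
abbreviation "F \<equiv> F_space X \<Omega> \<phi>"
abbreviation "N \<equiv> F_norm X \<Omega> \<phi>"
abbreviation "G \<equiv> G_space X \<Omega> \<phi>"
abbreviation "G' \<equiv> G_completion X \<Omega> \<phi>"

lemmas section_bounded_borel =
  C0_section[OF \<phi>, THEN C0_bounded_borel_on]

section \<open>Linearity of the two integral operators, and their values at point masses\<close>

lemma A_op_add:
  assumes "signed_measure_on \<Omega> \<mu>" "signed_measure_on \<Omega> \<nu>"
  shows "A (\<lambda>E. \<mu> E + \<nu> E) = (\<lambda>x. A \<mu> x + A \<nu> x)"
  using assms by (auto simp: A_op_def fun_eq_iff signed_integral_add_measure section_bounded_borel)

lemma A_op_cmult:
  assumes "signed_measure_on \<Omega> \<mu>"
  shows "A (\<lambda>E. c * \<mu> E) = (\<lambda>x. c * A \<mu> x)"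
  using assms by (auto simp: A_op_def fun_eq_iff signed_integral_cmult_measure section_bounded_borel)

lemma A_op_diff:
  assumes "signed_measure_on \<Omega> \<mu>" "signed_measure_on \<Omega> \<nu>"
  shows "A (\<lambda>E. \<mu> E - \<nu> E) = (\<lambda>x. A \<mu> x - A \<nu> x)"
  using A_op_add[OF assms(1) signed_measure_on_cmult[OF assms(2), of "-1"]]
    A_op_cmult[OF assms(2), of "-1"] by simp

lemma A_adj_add:
  assumes "signed_measure_on X \<mu>" "signed_measure_on X \<nu>"
  shows "A' (\<lambda>E. \<mu> E + \<nu> E) = (\<lambda>w. A' \<mu> w + A' \<nu> w)"
  using assms by (auto simp: A_adj_def fun_eq_iff signed_integral_add_measure section_bounded_borel)

lemma A_adj_cmult:
  assumes "signed_measure_on X \<mu>"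
  shows "A' (\<lambda>E. c * \<mu> E) = (\<lambda>w. c * A' \<mu> w)"
  using assms by (auto simp: A_adj_def fun_eq_iff signed_integral_cmult_measure section_bounded_borel)

lemma A_op_dirac: "w \<in> \<Omega> \<Longrightarrow> A (dirac_on \<Omega> w) = (\<lambda>x. \<phi> (x, w))"
  by (auto simp: A_op_def fun_eq_iff signed_integral_dirac section_bounded_borel C0_outside[OF \<phi>])

lemma A_adj_dirac: "x \<in> X \<Longrightarrow> A' (dirac_on X x) = (\<lambda>w. \<phi> (x, w))"
  by (auto simp: A_adj_def fun_eq_iff signed_integral_dirac section_bounded_borel C0_outside[OF \<phi>])

section \<open>The quotient norm on \<open>F\<close> and its completeness\<close>

lemma F_space_iff: "f \<in> F \<longleftrightarrow> (\<exists>\<mu>. signed_measure_on \<Omega> \<mu> \<and> f = A \<mu>)"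
  by (auto simp: F_space_def Meas_closed[OF \<Omega>])

lemma F_norm_le_tv_norm:
  assumes "signed_measure_on \<Omega> \<mu>"
  shows "N (A \<mu>) \<le> tv_norm \<Omega> \<mu>"
  unfolding F_norm_def
  by (rule cInf_lower) (use assms in \<open>auto simp: Meas_closed[OF \<Omega>] intro!: bdd_belowI[of _ 0] tv_norm_nonneg\<close>)

lemma F_norm_approx:
  assumes "f \<in> F" "N f < e"
  obtains \<mu> where "signed_measure_on \<Omega> \<mu>" "f = A \<mu>" "tv_norm \<Omega> \<mu> < e"
proof -
  have "{tv_norm \<Omega> \<mu> | \<mu>. \<mu> \<in> Meas \<Omega> \<and> f = A \<mu>} \<noteq> {}"
    using assms(1) by (auto simp: F_space_def)
  then show ?thesis
    using cInf_lessD[of "{tv_norm \<Omega> \<mu> | \<mu>. \<mu> \<in> Meas \<Omega> \<and> f = A \<mu>}" e] assms(2) that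
    unfolding F_norm_def by (auto simp: Meas_closed[OF \<Omega>])
qed

text \<open>The working form of the infimum: a bound that is linear in the total variation, valid
  for all representing measures, passes to \<open>N f\<close>. Dividing by \<open>C + 1\<close> in
  the proof also covers \<open>C = 0\<close>.\<close>

lemma F_norm_ge:
  assumes "f \<in> F" "\<And>\<mu>. signed_measure_on \<Omega> \<mu> \<Longrightarrow> f = A \<mu> \<Longrightarrow> c \<le> C * tv_norm \<Omega> \<mu>" "0 \<le> C"
  shows "c \<le> C * N f"
proof (rule field_le_epsilon)
  fix e :: real assume e: "e > 0"
  have "N f < N f + e / (C + 1)" using e \<open>0 \<le> C\<close> by simp
  then obtain \<mu> where \<mu>: "signed_measure_on \<Omega> \<mu>" "f = A \<mu>" "tv_norm \<Omega> \<mu> < N f + e / (C + 1)"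
    using F_norm_approx[OF assms(1)] by blast
  have "c \<le> C * (N f + e / (C + 1))"
    using assms(2)[OF \<mu>(1,2)] mult_left_mono[OF less_imp_le[OF \<mu>(3)] \<open>0 \<le> C\<close>] by linarith
  also have "\<dots> \<le> C * N f + e"
    using e \<open>0 \<le> C\<close> by (simp add: field_simps)
  finally show "c \<le> C * N f + e" .
qed

lemma F_norm_nonneg: "f \<in> F \<Longrightarrow> 0 \<le> N f"
  using F_norm_ge[of f 0 1] by (simp add: tv_norm_nonneg)

lemma F_space_add:
  assumes f: "f \<in> F" and g: "g \<in> F"
  shows "(\<lambda>x. f x + g x) \<in> F"
proof -
  obtain \<mu> \<nu> where \<mu>: "signed_measure_on \<Omega> \<mu>" "f = A \<mu>" and \<nu>: "signed_measure_on \<Omega> \<nu>" "g = A \<nu>"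
    using f g by (auto simp: F_space_iff)
  then show ?thesis
    unfolding F_space_iff
    by (auto simp: A_op_add intro!: exI[of _ "\<lambda>E. \<mu> E + \<nu> E"] signed_measure_on_add)
qed

lemma F_space_cmult:
  assumes f: "f \<in> F"
  shows "(\<lambda>x. c * f x) \<in> F"
proof -
  obtain \<mu> where \<mu>: "signed_measure_on \<Omega> \<mu>" "f = A \<mu>"
    using f by (auto simp: F_space_iff)
  then show ?thesis
    unfolding F_space_iff
    by (auto simp: A_op_cmult intro!: exI[of _ "\<lambda>E. c * \<mu> E"] signed_measure_on_cmult)
qed

lemma F_space_diff:
  assumes f: "f \<in> F" and g: "g \<in> F"
  shows "(\<lambda>x. f x - g x) \<in> F"
proof -
  obtain \<mu> \<nu> where \<mu>: "signed_measure_on \<Omega> \<mu>" "f = A \<mu>" and \<nu>: "signed_measure_on \<Omega> \<nu>" "g = A \<nu>"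
    using f g by (auto simp: F_space_iff)
  then show ?thesis
    unfolding F_space_iff
    by (auto simp: A_op_diff intro!: exI[of _ "\<lambda>E. \<mu> E - \<nu> E"] signed_measure_on_diff)
qed

lemma F_norm_add_le:
  assumes f: "f \<in> F" and g: "g \<in> F"
  shows "N (\<lambda>x. f x + g x) \<le> N f + N g"
proof -
  \<comment> \<open>The two infima are taken one after the other: first over the measures for
    \<open>f\<close>, with \<open>\<nu>\<close> fixed, then over \<open>\<nu>\<close>.\<close>
  have *: "N (\<lambda>x. f x + g x) - tv_norm \<Omega> \<nu> \<le> 1 * N f" if \<nu>: "signed_measure_on \<Omega> \<nu>" "g = A \<nu>" for \<nu>
  proof (rule F_norm_ge[OF f])
    fix \<mu> assume \<mu>: "signed_measure_on \<Omega> \<mu>" "f = A \<mu>"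
    show "N (\<lambda>x. f x + g x) - tv_norm \<Omega> \<nu> \<le> 1 * tv_norm \<Omega> \<mu>"
      using F_norm_le_tv_norm[OF signed_measure_on_add[OF \<mu>(1) \<nu>(1)]] tv_norm_add_le[OF \<mu>(1) \<nu>(1)]
      unfolding \<mu>(2) \<nu>(2) A_op_add[OF \<mu>(1) \<nu>(1)] by linarith
  qed simp
  have "N (\<lambda>x. f x + g x) - N f \<le> 1 * N g"
  proof (rule F_norm_ge[OF g])
    show "N (\<lambda>x. f x + g x) - N f \<le> 1 * tv_norm \<Omega> \<nu>" if "signed_measure_on \<Omega> \<nu>" "g = A \<nu>" for \<nu>
      using *[OF that] by linarith
  qed simp
  then show ?thesis by simp
qed

lemma F_norm_cmult_le:
  assumes f: "f \<in> F"
  shows "N (\<lambda>x. c * f x) \<le> \<bar>c\<bar> * N f"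
proof (rule F_norm_ge[OF f])
  fix \<mu> assume \<mu>: "signed_measure_on \<Omega> \<mu>" "f = A \<mu>"
  show "N (\<lambda>x. c * f x) \<le> \<bar>c\<bar> * tv_norm \<Omega> \<mu>"
    using F_norm_le_tv_norm[OF signed_measure_on_cmult[OF \<mu>(1), of c]] tv_norm_cmult_le[OF \<mu>(1), of c]
    unfolding \<mu>(2) A_op_cmult[OF \<mu>(1)] by linarith
qed simp

text \<open>Besides continuity of point evaluations this gives definiteness: \<open>N f = 0\<close>
  forces every value of \<open>f\<close> to vanish.\<close>

lemma F_evaluation_bound:
  assumes f: "f \<in> F" and x: "x \<in> X"
  shows "\<bar>f x\<bar> \<le> sup_norm (X \<times> \<Omega>) \<phi> * N f"
proof (rule F_norm_ge[OF f])
  note b = C0_bounded_borel_on[OF \<phi>]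
  show "0 \<le> sup_norm (X \<times> \<Omega>) \<phi>" by (rule sup_norm_nonneg[OF b])
  show "\<bar>f x\<bar> \<le> sup_norm (X \<times> \<Omega>) \<phi> * tv_norm \<Omega> \<mu>" if "signed_measure_on \<Omega> \<mu>" "f = A \<mu>" for \<mu>
    using that x abs_le_sup_norm[OF b]
    by (auto simp: A_op_def intro!: abs_signed_integral_le section_bounded_borel)
qed

lemma bounded_evaluations_F: "bounded_evaluations X F N"
  unfolding bounded_evaluations_def
proof (intro ballI exI conjI)
  have s: "0 \<le> sup_norm (X \<times> \<Omega>) \<phi>" by (rule sup_norm_nonneg[OF C0_bounded_borel_on[OF \<phi>]])
  \<comment> \<open>The supremum norm of \<open>\<phi>\<close> may be \<open>0\<close>, but the
    constant has to be positive.\<close>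
  then show "0 < sup_norm (X \<times> \<Omega>) \<phi> + 1" by simp
  fix x f assume "x \<in> X" "f \<in> F"
  then show "\<bar>f x\<bar> \<le> (sup_norm (X \<times> \<Omega>) \<phi> + 1) * N f"
    using F_evaluation_bound[of f x] F_norm_nonneg[of f] by (simp add: distrib_right)
qed

lemma F_space_zero: "(\<lambda>x. 0) \<in> F"
proof -
  have z: "signed_measure_on \<Omega> (\<lambda>E. 0)" by (simp add: signed_measure_on_def)
  have "A (\<lambda>E. 0) = (\<lambda>x. 0)" using A_op_cmult[OF z, of 0] by simp
  with z show ?thesis unfolding F_space_iff by metis
qed

lemma normed_fun_space_F: "normed_fun_space X F N"
proof (rule normed_fun_spaceI[OF _ F_space_zero F_space_add F_space_cmult F_norm_nonneg _
    F_norm_cmult_le F_norm_add_le])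
  show "f x = 0" if "f \<in> F" "x \<notin> X" for f x
    using that by (auto simp: F_space_iff A_op_def)
  show "f x = 0" if "f \<in> F" "N f = 0" "x \<in> X" for f x
    using F_evaluation_bound[OF that(1,3)] that(2) by simp
qed

text \<open>
  The usual argument for quotient norms: lift the increments of a rapidly Cauchy subsequence to
  measures of small total variation and sum these.
\<close>

lemma F_complete:
  assumes \<sigma>: "\<And>n::nat. \<sigma> n \<in> F"
    and cauchy: "\<And>\<epsilon>. \<epsilon> > 0 \<Longrightarrow> \<exists>M. \<forall>m\<ge>M. \<forall>n\<ge>M. N (\<lambda>x. \<sigma> m x - \<sigma> n x) < \<epsilon>"
  shows "\<exists>f\<in>F. (\<lambda>n. N (\<lambda>x. \<sigma> n x - f x)) \<longlonglongrightarrow> 0"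
proof -
  have "\<exists>M. \<forall>m\<ge>M. \<forall>n\<ge>M. N (\<lambda>x. \<sigma> m x - \<sigma> n x) < (1/2) ^ k" for k :: nat
    by (rule cauchy) simp
  then obtain M where M: "\<And>k m n. m \<ge> M k \<Longrightarrow> n \<ge> M k \<Longrightarrow> N (\<lambda>x. \<sigma> m x - \<sigma> n x) < (1/2) ^ k"
    by metis
  \<comment> \<open>Cumulative sums put both \<open>r k\<close> and \<open>r (Suc k)\<close> beyond
    \<open>M k\<close>, so consecutive terms of the subsequence differ by less than
    \<open>(1/2) ^ k\<close> in norm.\<close>
  define r where "r k = (\<Sum>i\<le>k. M i)" for k
  have rM: "M k \<le> r k" "M k \<le> r (Suc k)" for k
    using member_le_sum[of k "{..k}" M] by (auto simp: r_def)
  have "\<exists>\<mu>. signed_measure_on \<Omega> \<mu> \<and> (\<lambda>x. \<sigma> (r (Suc k)) x - \<sigma> (r k) x) = A \<mu> \<and> tv_norm \<Omega> \<mu> < (1/2) ^ k" for k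
    by (rule F_norm_approx[OF F_space_diff[OF \<sigma> \<sigma>] M[OF rM(2) rM(1), of k]]) (intro exI conjI)
  then obtain \<mu> where \<mu>: "\<And>k. signed_measure_on \<Omega> (\<mu> k)"
    and A\<mu>: "\<And>k. (\<lambda>x. \<sigma> (r (Suc k)) x - \<sigma> (r k) x) = A (\<mu> k)"
    and tv: "\<And>k. tv_norm \<Omega> (\<mu> k) < (1/2) ^ k" by metis
  define \<nu> where "\<nu> n E = (\<Sum>k<n. \<mu> k E)" for n E
  define \<mu>' where "\<mu>' E = (\<Sum>k. \<mu> k E)" for E
  have \<nu>: "signed_measure_on \<Omega> (\<nu> n) \<and> A (\<nu> n) = (\<lambda>x. \<sigma> (r n) x - \<sigma> (r 0) x)" for n
  proof (induction n)
    case 0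
    have "\<nu> 0 = (\<lambda>E. 0 * \<mu> 0 E)" by (simp add: \<nu>_def fun_eq_iff)
    then show ?case using signed_measure_on_cmult[OF \<mu>[of 0], of 0] A_op_cmult[OF \<mu>[of 0], of 0] by simp
  next
    case (Suc n)
    have eq: "\<nu> (Suc n) = (\<lambda>E. \<nu> n E + \<mu> n E)" by (simp add: \<nu>_def fun_eq_iff)
    have "A (\<nu> (Suc n)) = (\<lambda>x. A (\<nu> n) x + A (\<mu> n) x)"
      unfolding eq using Suc \<mu> by (intro A_op_add) auto
    also have "\<dots> = (\<lambda>x. \<sigma> (r (Suc n)) x - \<sigma> (r 0) x)"
      using Suc by (simp add: A\<mu>[symmetric])
    finally show ?case using Suc \<mu> signed_measure_on_add unfolding eq by blast
  qed
  \<comment> \<open>Each \<open>\<mu> k\<close> is bounded by \<open>(1/2) ^ k\<close> on every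
    Borel set, so the tail from \<open>n\<close> on is at most a geometric tail, uniformly in
    \<open>E\<close>.\<close>
  have bnd: "\<bar>\<nu> n E - \<mu>' E\<bar> \<le> 2 * (1/2) ^ n" if E: "E \<in> borel_sets_on \<Omega>" for n E
  proof -
    have le: "norm (\<mu> k E) \<le> (1/2) ^ k" for k
      using abs_add_abs_Diff_le_tv_norm[OF \<mu>[of k] E] tv[of k] by simp
    have geo: "summable (\<lambda>k. (1/2::real) ^ k)" by simp
    have sm: "summable (\<lambda>k. \<mu> k E)" by (rule summable_comparison_test'[OF geo le])
    have "\<mu>' E - \<nu> n E = (\<Sum>k. \<mu> (k + n) E)"
      unfolding \<mu>'_def \<nu>_def by (rule suminf_minus_initial_segment[OF sm, symmetric])
    also have "norm \<dots> \<le> (\<Sum>k. (1/2) ^ (k + n))"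
      by (rule norm_suminf_le[OF le summable_ignore_initial_segment[OF geo]])
    also have "(\<Sum>k. (1/2::real) ^ (k + n)) = (\<Sum>k. (1/2) ^ k) * (1/2) ^ n"
      unfolding power_add by (rule suminf_mult2[OF geo, symmetric])
    also have "(\<Sum>k. (1/2::real) ^ k) = 2"
      using suminf_geometric[of "1/2::real"] by simp
    finally show ?thesis by (simp add: abs_minus_commute)
  qed
  have lim: "(\<lambda>n. 2 * (1/2) ^ n :: real) \<longlonglongrightarrow> 0"
    using tendsto_mult_right_zero[OF LIMSEQ_realpow_zero[of "1/2"]] by simp
  have out: "\<mu>' E = 0" if "E \<notin> borel_sets_on \<Omega>" for E
    using that signed_measure_outside[OF \<mu>] by (simp add: \<mu>'_def)
  note unif = signed_measure_uniform_limit[of \<Omega> \<nu>, OF conjunct1[OF \<nu>] lim out bnd]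
  have \<mu>': "signed_measure_on \<Omega> \<mu>'" by (rule unif(1))
  \<comment> \<open>The increments telescope to \<open>\<sigma> (r n) - \<sigma> (r 0)\<close>, so
    the starting term is added back.\<close>
  define f where "f x = \<sigma> (r 0) x + A \<mu>' x" for x
  have f: "f \<in> F"
    unfolding f_def using \<sigma> \<mu>' by (intro F_space_add) (auto simp: F_space_iff)
  \<comment> \<open>The \<open>4\<close> is the \<open>2\<close> from the geometric tail times the
    \<open>2\<close> from \<open>signed_measure_uniform_limit\<close>.\<close>
  have sub: "N (\<lambda>x. \<sigma> (r n) x - f x) \<le> 4 * (1/2) ^ n" for n
  proof -
    have "A (\<lambda>E. \<nu> n E - \<mu>' E) = (\<lambda>x. A (\<nu> n) x - A \<mu>' x)"
      by (rule A_op_diff[OF conjunct1[OF \<nu>] \<mu>'])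
    also have "\<dots> = (\<lambda>x. \<sigma> (r n) x - f x)"
      unfolding conjunct2[OF \<nu>] f_def by (simp add: algebra_simps)
    finally have eq: "A (\<lambda>E. \<nu> n E - \<mu>' E) = (\<lambda>x. \<sigma> (r n) x - f x)" .
    show ?thesis
      using F_norm_le_tv_norm[OF signed_measure_on_diff[OF conjunct1[OF \<nu>] \<mu>'], of n] unif(2)[of n]
      unfolding eq by linarith
  qed
  have "(\<lambda>n. N (\<lambda>x. \<sigma> n x - f x)) \<longlonglongrightarrow> 0"
  proof (rule LIMSEQ_I)
    fix e :: real assume "e > 0"
    \<comment> \<open>\<open>5\<close> collects the \<open>4\<close> from \<open>sub\<close> and the
      \<open>1\<close> from the Cauchy estimate between \<open>\<sigma> m\<close> and
      \<open>\<sigma> (r n)\<close>.\<close>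
    then obtain n where n: "(1/2) ^ n < e / 5"
      using real_arch_pow_inv[of "e / 5" "1/2"] by auto
    have "norm (N (\<lambda>x. \<sigma> m x - f x) - 0) < e" if m: "m \<ge> r n" for m
    proof -
      have "N (\<lambda>x. (\<sigma> m x - \<sigma> (r n) x) + (\<sigma> (r n) x - f x)) \<le>
          N (\<lambda>x. \<sigma> m x - \<sigma> (r n) x) + N (\<lambda>x. \<sigma> (r n) x - f x)"
        by (intro F_norm_add_le F_space_diff \<sigma> f)
      moreover have "N (\<lambda>x. \<sigma> m x - \<sigma> (r n) x) < (1/2) ^ n"
        using m rM(1)[of n] by (intro M) auto
      ultimately show ?thesis
        using sub[of n] n F_norm_nonneg[OF F_space_diff[OF \<sigma> f], of m] by simp
    qed
    then show "\<exists>M. \<forall>m\<ge>M. norm (N (\<lambda>x. \<sigma> m x - f x) - 0) < e" by blast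
  qed
  with f show ?thesis by blast
qed

lemma rkbs_F: "rkbs X F N"
  unfolding rkbs_def banach_fun_space_def
  using normed_fun_space_F F_complete bounded_evaluations_F by blast

section \<open>\<open>G\<close> and its closure in \<open>C0 \<Omega>\<close>\<close>

lemma G_space_iff: "g \<in> G \<longleftrightarrow> g \<in> C0 \<Omega> \<and> (\<exists>\<rho>. signed_measure_on X \<rho> \<and> g = A' \<rho>)"
  by (auto simp: G_space_def Meas_closed[OF X])

lemma G_space_add:
  assumes f: "f \<in> G" and g: "g \<in> G"
  shows "(\<lambda>w. f w + g w) \<in> G"
proof -
  obtain \<mu> \<nu> where \<mu>: "signed_measure_on X \<mu>" "f = A' \<mu>" and \<nu>: "signed_measure_on X \<nu>" "g = A' \<nu>"
    using f g by (auto simp: G_space_iff)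
  moreover have "(\<lambda>w. f w + g w) \<in> C0 \<Omega>" using f g by (intro C0_add) (simp_all add: G_space_iff)
  ultimately show ?thesis
    unfolding G_space_iff
    by (auto simp: A_adj_add intro!: exI[of _ "\<lambda>E. \<mu> E + \<nu> E"] signed_measure_on_add)
qed

lemma G_space_cmult:
  assumes f: "f \<in> G"
  shows "(\<lambda>w. c * f w) \<in> G"
proof -
  obtain \<mu> where \<mu>: "signed_measure_on X \<mu>" "f = A' \<mu>"
    using f by (auto simp: G_space_iff)
  moreover have "(\<lambda>w. c * f w) \<in> C0 \<Omega>" using f by (intro C0_cmult) (simp add: G_space_iff)
  ultimately show ?thesis
    unfolding G_space_iff
    by (auto simp: A_adj_cmult intro!: exI[of _ "\<lambda>E. c * \<mu> E"] signed_measure_on_cmult)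
qed

lemma G_space_zero: "(\<lambda>w. 0) \<in> G"
proof -
  have "signed_measure_on X (\<lambda>E. 0)" by (simp add: signed_measure_on_def)
  from A_adj_cmult[OF this, of 0] this C0_zero show ?thesis
    unfolding G_space_iff by (intro conjI exI[of _ "\<lambda>E. 0"]) auto
qed

text \<open>The pointwise form lets approximations be combined without handling suprema. Halving
  \<open>\<epsilon>\<close> in one direction makes up for a strict pointwise bound being only weak
  for the supremum.\<close>

lemma G_completion_iff:
  "g \<in> G' \<longleftrightarrow> g \<in> C0 \<Omega> \<and> (\<forall>\<epsilon>>0. \<exists>h\<in>G. \<forall>w\<in>\<Omega>. \<bar>g w - h w\<bar> < \<epsilon>)"
proof (intro iffI conjI allI impI)
  fix \<epsilon> :: real assume g: "g \<in> G'" and "\<epsilon> > 0"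
  then obtain h where h: "h \<in> G" "sup_norm \<Omega> (\<lambda>w. g w - h w) < \<epsilon>"
    by (auto simp: G_completion_def)
  have "bounded_borel_on \<Omega> (\<lambda>w. g w - h w)"
    using g h by (intro C0_bounded_borel_on C0_diff) (auto simp: G_completion_def G_space_def)
  with h show "\<exists>h\<in>G. \<forall>w\<in>\<Omega>. \<bar>g w - h w\<bar> < \<epsilon>"
    using abs_le_sup_norm by (intro bexI[of _ h]) fastforce+
next
  assume g: "g \<in> C0 \<Omega> \<and> (\<forall>\<epsilon>>0. \<exists>h\<in>G. \<forall>w\<in>\<Omega>. \<bar>g w - h w\<bar> < \<epsilon>)"
  have "\<exists>h\<in>G. sup_norm \<Omega> (\<lambda>w. g w - h w) < \<epsilon>" if "\<epsilon> > 0" for \<epsilon>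
  proof -
    have "\<epsilon> / 2 > 0" using that by simp
    then obtain h where h: "h \<in> G" "\<And>w. w \<in> \<Omega> \<Longrightarrow> \<bar>g w - h w\<bar> < \<epsilon> / 2" using g by blast
    have "sup_norm \<Omega> (\<lambda>w. g w - h w) \<le> \<epsilon> / 2"
      by (rule sup_norm_le[OF _ less_imp_le[OF h(2)]]) (use that in simp)
    with h that show ?thesis by (intro bexI[of _ h]) auto
  qed
  with g show "g \<in> G'" by (simp add: G_completion_def)
qed (simp add: G_completion_def)

lemma G_space_subset_completion: "G \<subseteq> G'"
proof
  fix g assume g: "g \<in> G"
  then have "\<forall>w\<in>\<Omega>. \<bar>g w - g w\<bar> < \<epsilon>" if "\<epsilon> > 0" for \<epsilon> using that by simp
  with g show "g \<in> G'" unfolding G_completion_iff by (blast intro: G_space_iff[THEN iffD1, THEN conjunct1])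
qed

lemma G_completion_approx:
  "g \<in> G' \<Longrightarrow> \<epsilon> > 0 \<Longrightarrow> \<exists>h\<in>G. \<forall>w\<in>\<Omega>. \<bar>g w - h w\<bar> < \<epsilon>"
  unfolding G_completion_iff by blast

lemma G_completion_add:
  assumes g: "g \<in> G'" and h: "h \<in> G'"
  shows "(\<lambda>w. g w + h w) \<in> G'"
proof -
  have "\<exists>k\<in>G. \<forall>w\<in>\<Omega>. \<bar>g w + h w - k w\<bar> < \<epsilon>" if "\<epsilon> > 0" for \<epsilon>
  proof -
    have half: "\<epsilon> / 2 > 0" using that by simp
    obtain g1 where g1: "g1 \<in> G" "\<And>w. w \<in> \<Omega> \<Longrightarrow> \<bar>g w - g1 w\<bar> < \<epsilon> / 2"
      using G_completion_approx[OF g half] by blast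
    obtain h1 where h1: "h1 \<in> G" "\<And>w. w \<in> \<Omega> \<Longrightarrow> \<bar>h w - h1 w\<bar> < \<epsilon> / 2"
      using G_completion_approx[OF h half] by blast
    have "\<bar>g w + h w - (g1 w + h1 w)\<bar> < \<epsilon>" if "w \<in> \<Omega>" for w
      using g1(2)[OF that] h1(2)[OF that] by linarith
    then show ?thesis by (intro bexI[OF _ G_space_add[OF g1(1) h1(1)]] ballI)
  qed
  moreover have "(\<lambda>w. g w + h w) \<in> C0 \<Omega>"
    using g h by (intro C0_add) (simp_all add: G_completion_iff)
  ultimately show ?thesis unfolding G_completion_iff by blast
qed

lemma G_completion_cmult:
  assumes g: "g \<in> G'"
  shows "(\<lambda>w. c * g w) \<in> G'"
proof -
  have "\<exists>k\<in>G. \<forall>w\<in>\<Omega>. \<bar>c * g w - k w\<bar> < \<epsilon>" if "\<epsilon> > 0" for \<epsilon>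
  proof -
    have "\<epsilon> / (\<bar>c\<bar> + 1) > 0" using that by simp
    then obtain h where h: "h \<in> G" "\<And>w. w \<in> \<Omega> \<Longrightarrow> \<bar>g w - h w\<bar> < \<epsilon> / (\<bar>c\<bar> + 1)"
      using G_completion_approx[OF g] by blast
    have "\<bar>c * g w - c * h w\<bar> < \<epsilon>" if "w \<in> \<Omega>" for w
    proof -
      have "\<bar>c * g w - c * h w\<bar> = \<bar>c\<bar> * \<bar>g w - h w\<bar>"
        by (simp flip: abs_mult add: right_diff_distrib)
      also have "\<dots> \<le> \<bar>g w - h w\<bar> * (\<bar>c\<bar> + 1)" by (simp add: distrib_left)
      also have "\<dots> < \<epsilon>" using h(2)[OF that] by (simp add: pos_less_divide_eq)
      finally show ?thesis .
    qed
    then show ?thesis by (intro bexI[OF _ G_space_cmult[OF h(1), of c]] ballI)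
  qed
  moreover have "(\<lambda>w. c * g w) \<in> C0 \<Omega>"
    using g by (intro C0_cmult) (simp add: G_completion_iff)
  ultimately show ?thesis unfolding G_completion_iff by blast
qed

text \<open>A uniformly Cauchy sequence converges uniformly to its pointwise limit, which stays in
  \<open>C0 \<Omega>\<close> by \<open>C0_uniform_limit\<close>; an element of \<open>G\<close>
  close to a late term is also close to the limit.\<close>

lemma G_completion_complete:
  assumes \<sigma>: "\<And>n::nat. \<sigma> n \<in> G'"
    and cauchy: "\<And>\<epsilon>. \<epsilon> > 0 \<Longrightarrow> \<exists>M. \<forall>m\<ge>M. \<forall>n\<ge>M. sup_norm \<Omega> (\<lambda>w. \<sigma> m w - \<sigma> n w) < \<epsilon>"
  shows "\<exists>g\<in>G'. (\<lambda>n. sup_norm \<Omega> (\<lambda>w. \<sigma> n w - g w)) \<longlonglongrightarrow> 0"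
proof -
  have C0\<sigma>: "\<sigma> n \<in> C0 \<Omega>" for n using \<sigma> by (simp add: G_completion_iff)
  have uc: "\<exists>M. \<forall>m\<ge>M. \<forall>n\<ge>M. \<forall>w\<in>\<Omega>. \<bar>\<sigma> m w - \<sigma> n w\<bar> < \<epsilon>" if "\<epsilon> > 0" for \<epsilon>
    using cauchy[OF that] abs_le_sup_norm[OF C0_bounded_borel_on[OF C0_diff[OF C0\<sigma> C0\<sigma>]]]
    by (meson le_less_trans)
  \<comment> \<open>Off \<open>\<Omega>\<close> the sequence is constantly \<open>0\<close>, so
    \<open>lim\<close> returns the prescribed value there as well.\<close>
  define g where "g w = lim (\<lambda>n. \<sigma> n w)" for w
  have lim: "(\<lambda>n. \<sigma> n w) \<longlonglongrightarrow> g w" if "w \<in> \<Omega>" for w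
  proof -
    have "Cauchy (\<lambda>n. \<sigma> n w)"
      unfolding Cauchy_def dist_real_def using uc that by meson
    then show ?thesis by (simp add: g_def Cauchy_convergent_iff convergent_LIMSEQ_iff)
  qed
  have out: "g w = 0" if "w \<notin> \<Omega>" for w
    using that C0_outside[OF C0\<sigma>] by (simp add: g_def)
  have ul: "\<exists>M. \<forall>m\<ge>M. \<forall>w\<in>\<Omega>. \<bar>\<sigma> m w - g w\<bar> < \<epsilon>" if "\<epsilon> > 0" for \<epsilon>
  proof -
    have "\<epsilon> / 2 > 0" using that by simp
    then obtain M where M: "\<And>m n w. m \<ge> M \<Longrightarrow> n \<ge> M \<Longrightarrow> w \<in> \<Omega> \<Longrightarrow> \<bar>\<sigma> m w - \<sigma> n w\<bar> < \<epsilon> / 2"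
      using uc by meson
    have "\<bar>\<sigma> m w - g w\<bar> < \<epsilon>" if "m \<ge> M" "w \<in> \<Omega>" for m w
    proof -
      have "(\<lambda>n. \<bar>\<sigma> m w - \<sigma> n w\<bar>) \<longlonglongrightarrow> \<bar>\<sigma> m w - g w\<bar>"
        by (intro tendsto_intros lim that)
      then have "\<bar>\<sigma> m w - g w\<bar> \<le> \<epsilon> / 2"
        by (rule LIMSEQ_le_const2) (use M that less_imp_le in blast)
      with \<open>\<epsilon> > 0\<close> show ?thesis by simp
    qed
    then show ?thesis by blast
  qed
  have gC0: "g \<in> C0 \<Omega>"
  proof (rule C0_uniform_limit[OF out])
    fix \<epsilon> :: real assume "\<epsilon> > 0"
    then obtain m where "\<forall>w\<in>\<Omega>. \<bar>\<sigma> m w - g w\<bar> < \<epsilon>" using ul by blast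
    then show "\<exists>h\<in>C0 \<Omega>. \<forall>w\<in>\<Omega>. \<bar>g w - h w\<bar> < \<epsilon>"
      by (intro bexI[OF _ C0\<sigma>[of m]]) (simp add: abs_minus_commute)
  qed
  have "g \<in> G'"
    unfolding G_completion_iff
  proof (intro conjI gC0 allI impI)
    fix \<epsilon> :: real assume "\<epsilon> > 0"
    then have half: "\<epsilon> / 2 > 0" by simp
    obtain m where m: "\<And>w. w \<in> \<Omega> \<Longrightarrow> \<bar>\<sigma> m w - g w\<bar> < \<epsilon> / 2"
      using ul[OF half] by blast
    obtain h where h: "h \<in> G" "\<And>w. w \<in> \<Omega> \<Longrightarrow> \<bar>\<sigma> m w - h w\<bar> < \<epsilon> / 2"
      using G_completion_approx[OF \<sigma> half, of m] by blast
    have "\<bar>g w - h w\<bar> < \<epsilon>" if "w \<in> \<Omega>" for w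
      using m[OF that] h(2)[OF that] by linarith
    with h show "\<exists>h\<in>G. \<forall>w\<in>\<Omega>. \<bar>g w - h w\<bar> < \<epsilon>" by blast
  qed
  moreover have "(\<lambda>n. sup_norm \<Omega> (\<lambda>w. \<sigma> n w - g w)) \<longlonglongrightarrow> 0"
  proof (rule LIMSEQ_I)
    fix e :: real assume "e > 0"
    then have "e / 2 > 0" by simp
    then obtain M where M: "\<And>m w. m \<ge> M \<Longrightarrow> w \<in> \<Omega> \<Longrightarrow> \<bar>\<sigma> m w - g w\<bar> < e / 2"
      using ul by meson
    have "norm (sup_norm \<Omega> (\<lambda>w. \<sigma> m w - g w) - 0) < e" if "m \<ge> M" for m
    proof -
      have "sup_norm \<Omega> (\<lambda>w. \<sigma> m w - g w) \<le> e / 2"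
        by (rule sup_norm_le[OF _ less_imp_le[OF M[OF that]]]) (use \<open>e > 0\<close> in simp)
      then show ?thesis
        using \<open>e > 0\<close> sup_norm_nonneg[OF C0_bounded_borel_on[OF C0_diff[OF C0\<sigma> gC0]], of m] by simp
    qed
    then show "\<exists>M. \<forall>m\<ge>M. norm (sup_norm \<Omega> (\<lambda>w. \<sigma> m w - g w) - 0) < e" by blast
  qed
  ultimately show ?thesis by blast
qed

lemma pre_rkbs_G: "pre_rkbs \<Omega> G (sup_norm \<Omega>)"
  unfolding pre_rkbs_def
  by (intro conjI normed_fun_space_sup_norm bounded_evaluations_sup_norm
    G_space_zero G_space_add G_space_cmult) (auto simp: G_space_def)

lemma rkbs_G_completion: "rkbs \<Omega> G' (sup_norm \<Omega>)"
proof -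
  have sub: "G' \<subseteq> C0 \<Omega>" by (auto simp: G_completion_def)
  have "(\<lambda>w. 0) \<in> G'" using G_space_zero G_space_subset_completion by blast
  then have "normed_fun_space \<Omega> G' (sup_norm \<Omega>)"
    by (intro normed_fun_space_sup_norm sub G_completion_add G_completion_cmult)
  then show ?thesis
    unfolding rkbs_def banach_fun_space_def
    using G_completion_complete bounded_evaluations_sup_norm[OF sub] by blast
qed

section \<open>The pairing, its extension to the closure, and the embedding into the dual\<close>

lemma signed_integral_A_adj:
  assumes \<mu>: "signed_measure_on \<Omega> \<mu>" and \<rho>: "signed_measure_on X \<rho>"
  shows "signed_integral (X \<times> \<Omega>) (signed_prod X \<Omega> \<rho> \<mu>) \<phi> = signed_integral \<Omega> \<mu> (A' \<rho>)"
    "signed_integral (X \<times> \<Omega>) (signed_prod X \<Omega> \<rho> \<mu>) \<phi> = signed_integral X \<rho> (A \<mu>)"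
proof -
  note prod = signed_integral_signed_prod[OF \<rho> \<mu> C0_bounded_borel_on[OF \<phi>]]
  show "signed_integral (X \<times> \<Omega>) (signed_prod X \<Omega> \<rho> \<mu>) \<phi> = signed_integral \<Omega> \<mu> (A' \<rho>)"
    unfolding prod(2) by (rule signed_integral_cong[OF \<mu>]) (simp add: A_adj_def)
  show "signed_integral (X \<times> \<Omega>) (signed_prod X \<Omega> \<rho> \<mu>) \<phi> = signed_integral X \<rho> (A \<mu>)"
    unfolding prod(1) by (rule signed_integral_cong[OF \<rho>]) (simp add: A_op_def)
qed

lemma FG_pairing_eq:
  assumes \<mu>: "signed_measure_on \<Omega> \<mu>" and g: "g \<in> G"
  shows "FG_pairing X \<Omega> \<phi> (A \<mu>) g = signed_integral \<Omega> \<mu> g"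
proof -
  obtain \<rho> where \<rho>: "signed_measure_on X \<rho>" "g = A' \<rho>" using g by (auto simp: G_space_iff)
  show ?thesis
    unfolding FG_pairing_def
  proof (rule the_equality)
    show "\<exists>\<mu>'\<in>Meas \<Omega>. \<exists>\<rho>\<in>Meas X. A \<mu> = A \<mu>' \<and> g = A' \<rho> \<and>
        signed_integral \<Omega> \<mu> g = signed_integral (X \<times> \<Omega>) (signed_prod X \<Omega> \<rho> \<mu>') \<phi>"
      using \<mu> \<rho> signed_integral_A_adj(1)[OF \<mu> \<rho>(1)]
      by (intro bexI[of _ \<mu>] bexI[of _ \<rho>]) (simp_all add: Meas_closed X \<Omega>)
  next
    fix c assume "\<exists>\<mu>'\<in>Meas \<Omega>. \<exists>\<rho>\<in>Meas X. A \<mu> = A \<mu>' \<and> g = A' \<rho> \<and>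
        c = signed_integral (X \<times> \<Omega>) (signed_prod X \<Omega> \<rho> \<mu>') \<phi>"
    then obtain \<mu>' \<rho>' where *: "signed_measure_on \<Omega> \<mu>'" "signed_measure_on X \<rho>'"
        "A \<mu> = A \<mu>'" "g = A' \<rho>'" "c = signed_integral (X \<times> \<Omega>) (signed_prod X \<Omega> \<rho>' \<mu>') \<phi>"
      by (auto simp: Meas_closed X \<Omega>)
    \<comment> \<open>With \<open>\<rho>'\<close> fixed, the second identity replaces
      \<open>\<mu>'\<close> by \<open>\<mu>\<close>, since both have the same image under
      \<open>A\<close>; the first identity then eliminates \<open>\<rho>'\<close>.\<close>
    then show "c = signed_integral \<Omega> \<mu> g"
      using signed_integral_A_adj[OF *(1,2)] signed_integral_A_adj[OF \<mu> *(2)] by simp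
  qed
qed

lemma signed_integral_well_defined:
  assumes \<mu>: "signed_measure_on \<Omega> \<mu>" and \<nu>: "signed_measure_on \<Omega> \<nu>" and eq: "A \<mu> = A \<nu>"
    and g: "g \<in> G'"
  shows "signed_integral \<Omega> \<mu> g = signed_integral \<Omega> \<nu> g"
proof -
  \<comment> \<open>Replacing \<open>g\<close> by an approximant within \<open>e / T\<close> changes
    the two integrals by at most \<open>e\<close> together. The summand \<open>1\<close> keeps
    \<open>T\<close> positive when both measures vanish.\<close>
  define T where "T = tv_norm \<Omega> \<mu> + tv_norm \<Omega> \<nu> + 1"
  have T: "T > 0" using tv_norm_nonneg[OF \<mu>] tv_norm_nonneg[OF \<nu>] by (simp add: T_def)
  have gb: "bounded_borel_on \<Omega> g" using g by (auto simp: G_completion_iff intro: C0_bounded_borel_on)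
  have "\<bar>signed_integral \<Omega> \<mu> g - signed_integral \<Omega> \<nu> g\<bar> \<le> 0 + e" if "e > 0" for e
  proof -
    have "e / T > 0" using that T by simp
    then obtain h where h: "h \<in> G" "\<And>w. w \<in> \<Omega> \<Longrightarrow> \<bar>g w - h w\<bar> < e / T"
      using G_completion_approx[OF g] by blast
    have hb: "bounded_borel_on \<Omega> h" using h by (auto simp: G_space_iff intro: C0_bounded_borel_on)
    have bound: "\<bar>signed_integral \<Omega> \<kappa> g - signed_integral \<Omega> \<kappa> h\<bar> \<le> e / T * tv_norm \<Omega> \<kappa>"
      if \<kappa>: "signed_measure_on \<Omega> \<kappa>" for \<kappa>
      using signed_integral_add[OF \<kappa> bounded_borel_on_diff[OF gb hb] hb]
        abs_signed_integral_le[OF \<kappa> bounded_borel_on_diff[OF gb hb] less_imp_le[OF h(2)]] by simp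
    have "signed_integral \<Omega> \<mu> h = signed_integral \<Omega> \<nu> h"
      using FG_pairing_eq[OF \<mu> h(1)] FG_pairing_eq[OF \<nu> h(1)] eq by simp
    then have "\<bar>signed_integral \<Omega> \<mu> g - signed_integral \<Omega> \<nu> g\<bar> \<le> e / T * (tv_norm \<Omega> \<mu> + tv_norm \<Omega> \<nu>)"
      using bound[OF \<mu>] bound[OF \<nu>] unfolding distrib_left by linarith
    also have "\<dots> \<le> e / T * T"
      using \<open>e / T > 0\<close> by (intro mult_left_mono) (auto simp: T_def)
    finally show ?thesis using T by simp
  qed
  then have "\<bar>signed_integral \<Omega> \<mu> g - signed_integral \<Omega> \<nu> g\<bar> \<le> 0"
    by (rule field_le_epsilon)
  then show ?thesis by simp
qed

text \<open>One argument for \<open>B = G\<close> with \<open>FG_pairing\<close> and for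
  \<open>B = G'\<close> with the extended pairing. Of the pairing it uses only \<open>P\<close>,
  that is, integration against any representing measure; \<open>G \<subseteq> B\<close> puts the
  sections \<open>\<phi> (x, -)\<close> into \<open>B\<close>.\<close>

lemma adjoint_reproducingI:
  assumes sub: "G \<subseteq> B" "B \<subseteq> C0 \<Omega>"
    and add: "\<And>g h. g \<in> B \<Longrightarrow> h \<in> B \<Longrightarrow> (\<lambda>w. g w + h w) \<in> B"
    and cmult: "\<And>c g. g \<in> B \<Longrightarrow> (\<lambda>w. c * g w) \<in> B"
    and P: "\<And>\<mu> g. signed_measure_on \<Omega> \<mu> \<Longrightarrow> g \<in> B \<Longrightarrow> P (A \<mu>) g = signed_integral \<Omega> \<mu> g"
  shows "adjoint_reproducing X F N \<Omega> B (sup_norm \<Omega>) P \<phi>"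
proof -
  have bb: "bounded_borel_on \<Omega> g" if "g \<in> B" for g
    using that sub C0_bounded_borel_on by blast
  have Padd: "P (\<lambda>x. f x + k x) g = P f g + P k g" if fk: "f \<in> F" "k \<in> F" and g: "g \<in> B" for f k g
  proof -
    obtain \<mu> \<nu> where "signed_measure_on \<Omega> \<mu>" "f = A \<mu>" "signed_measure_on \<Omega> \<nu>" "k = A \<nu>"
      using fk by (auto simp: F_space_iff)
    then show ?thesis
      using P[OF signed_measure_on_add g, of \<mu> \<nu>] g bb
      by (simp add: A_op_add P signed_integral_add_measure)
  qed
  have Pcmult: "P (\<lambda>x. c * f x) g = c * P f g" if f: "f \<in> F" and g: "g \<in> B" for c f g
  proof -
    obtain \<mu> where "signed_measure_on \<Omega> \<mu>" "f = A \<mu>"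
      using f by (auto simp: F_space_iff)
    then show ?thesis
      using P[OF signed_measure_on_cmult g, of \<mu> c] g bb
      by (simp add: A_op_cmult P signed_integral_cmult_measure)
  qed
  have Pbound: "\<bar>P f g\<bar> \<le> sup_norm \<Omega> g * N f" if f: "f \<in> F" and g: "g \<in> B" for f g
  proof (rule F_norm_ge[OF f])
    show "\<bar>P f g\<bar> \<le> sup_norm \<Omega> g * tv_norm \<Omega> \<mu>" if "signed_measure_on \<Omega> \<mu>" "f = A \<mu>" for \<mu>
      using that g abs_signed_integral_le[OF that(1) bb[OF g] abs_le_sup_norm[OF bb[OF g]]]
      by (simp add: P)
  qed (rule sup_norm_nonneg[OF bb[OF g]])
  have dual: "dual_elem F N (\<lambda>f. P f g)" if "g \<in> B" for g
    unfolding dual_elem_def using Padd Pcmult Pbound that by blast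
  have Padd2: "P f (\<lambda>w. g w + h w) = P f g + P f h" if f: "f \<in> F" and "g \<in> B" "h \<in> B" for f g h
    using f that bb add by (auto simp: F_space_iff P signed_integral_add)
  have Pcmult2: "P f (\<lambda>w. c * g w) = c * P f g" if f: "f \<in> F" and "g \<in> B" for c f g
    using f that cmult by (auto simp: F_space_iff P signed_integral_cmult)
  have dirac: "(\<lambda>x. \<phi> (x, w)) \<in> F" "N (\<lambda>x. \<phi> (x, w)) \<le> 1" "\<And>g. g \<in> B \<Longrightarrow> P (\<lambda>x. \<phi> (x, w)) g = g w"
    if w: "w \<in> \<Omega>" for w
  proof -
    note d = signed_measure_on_dirac[OF w]
    show "(\<lambda>x. \<phi> (x, w)) \<in> F"
      unfolding F_space_iff using d A_op_dirac[OF w] by metis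
    show "N (\<lambda>x. \<phi> (x, w)) \<le> 1"
      using F_norm_le_tv_norm[OF d] tv_norm_dirac[OF w] by (simp add: A_op_dirac[OF w])
    show "P (\<lambda>x. \<phi> (x, w)) g = g w" if "g \<in> B" for g
      using P[OF d that] signed_integral_dirac[OF w bb[OF that]] by (simp add: A_op_dirac[OF w])
  qed
  have zeroF: "(\<lambda>x. 0) \<in> F" "N (\<lambda>x. 0) = 0"
    using normed_fun_space_F by (auto simp: normed_fun_space_def)
  \<comment> \<open>The functions \<open>\<phi> (-, w)\<close> lie in the unit ball and pair with
    \<open>g\<close> to \<open>g w\<close>, which gives the lower bound. The factors
    \<open>1\<close> are the witnesses for the constants in
    \<open>embeds_into_dual_def\<close>.\<close>
  have norms: "1 * sup_norm \<Omega> g \<le> dual_norm F N (\<lambda>f. P f g)"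
    "dual_norm F N (\<lambda>f. P f g) \<le> 1 * sup_norm \<Omega> g" if g: "g \<in> B" for g
  proof -
    let ?D = "{\<bar>P f g\<bar> | f. f \<in> F \<and> N f \<le> 1}"
    have le: "\<bar>P f g\<bar> \<le> sup_norm \<Omega> g" if "f \<in> F" "N f \<le> 1" for f
      using Pbound[OF that(1) g] mult_left_mono[OF that(2) sup_norm_nonneg[OF bb[OF g]]] by simp
    have bdd: "bdd_above ?D" using le by (intro bdd_aboveI[of _ "sup_norm \<Omega> g"]) blast
    \<comment> \<open>The zero function makes \<open>?D\<close> nonempty and its supremum
      nonnegative, also when \<open>\<Omega>\<close> is empty.\<close>
    have z: "\<bar>P (\<lambda>x. 0) g\<bar> \<in> ?D" using zeroF by force
    have "sup_norm \<Omega> g \<le> Sup ?D"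
    proof (rule sup_norm_le)
      show "0 \<le> Sup ?D" using cSup_upper[OF z bdd] by simp
      show "\<bar>g w\<bar> \<le> Sup ?D" if "w \<in> \<Omega>" for w
        by (rule cSup_upper[OF _ bdd]) (use dirac[OF that] g in force)
    qed
    then show "1 * sup_norm \<Omega> g \<le> dual_norm F N (\<lambda>f. P f g)" by (simp add: dual_norm_def)
    have "Sup ?D \<le> sup_norm \<Omega> g"
      by (rule cSup_least) (use z le in blast)+
    then show "dual_norm F N (\<lambda>f. P f g) \<le> 1 * sup_norm \<Omega> g" by (simp add: dual_norm_def)
  qed
  have "embeds_into_dual F N B (sup_norm \<Omega>) P"
    unfolding embeds_into_dual_def
    using dual Padd2 Pcmult2 norms zero_less_one by blast
  moreover have sect: "(\<lambda>w. \<phi> (x, w)) \<in> B" if x: "x \<in> X" for x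
    using sub(1) signed_measure_on_dirac[OF x] A_adj_dirac[OF x] C0_section(1)[OF \<phi> x]
    unfolding G_space_iff[abs_def] by (metis G_space_iff subsetD)
  moreover have "f x = P f (\<lambda>w. \<phi> (x, w))" if x: "x \<in> X" and f: "f \<in> F" for x f
  proof -
    obtain \<mu> where \<mu>: "signed_measure_on \<Omega> \<mu>" "f = A \<mu>" using f by (auto simp: F_space_iff)
    show ?thesis
      unfolding \<mu>(2) P[OF \<mu>(1) sect[OF x]] using x by (simp add: A_op_def)
  qed
  ultimately show ?thesis
    unfolding adjoint_reproducing_def using dirac by simp
qed

theorem adjoint_pair_F_G:
  "adjoint_pre_pair X F N \<Omega> G (sup_norm \<Omega>) (FG_pairing X \<Omega> \<phi>) \<phi> \<and>
    (\<exists>P. (\<forall>f\<in>F. \<forall>g\<in>G. P f g = FG_pairing X \<Omega> \<phi> f g) \<and>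
      adjoint_pair X F N \<Omega> G' (sup_norm \<Omega>) P \<phi>)"
proof (intro conjI exI[of _ "\<lambda>f. signed_integral \<Omega> (SOME \<mu>. signed_measure_on \<Omega> \<mu> \<and> f = A \<mu>)"])
  \<comment> \<open>The extended pairing integrates against an arbitrarily chosen representing
    measure; \<open>signed_integral_well_defined\<close> makes the choice irrelevant for
    \<open>g\<close> in the closure.\<close>
  let ?P = "\<lambda>f. signed_integral \<Omega> (SOME \<mu>. signed_measure_on \<Omega> \<mu> \<and> f = A \<mu>)"
  have P: "?P (A \<mu>) g = signed_integral \<Omega> \<mu> g" if \<mu>: "signed_measure_on \<Omega> \<mu>" and g: "g \<in> G'" for \<mu> g
  proof -
    have "\<exists>\<nu>. signed_measure_on \<Omega> \<nu> \<and> A \<mu> = A \<nu>" using \<mu> by blast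
    from someI_ex[OF this] show ?thesis
      using \<mu> g by (metis (no_types, lifting) signed_integral_well_defined)
  qed
  have "adjoint_reproducing X F N \<Omega> G (sup_norm \<Omega>) (FG_pairing X \<Omega> \<phi>) \<phi>"
    by (intro adjoint_reproducingI order_refl G_space_add G_space_cmult FG_pairing_eq)
      (auto simp: G_space_def)
  then show "adjoint_pre_pair X F N \<Omega> G (sup_norm \<Omega>) (FG_pairing X \<Omega> \<phi>) \<phi>"
    unfolding adjoint_pre_pair_def using rkbs_F pre_rkbs_G by blast
  have "adjoint_reproducing X F N \<Omega> G' (sup_norm \<Omega>) ?P \<phi>"
    by (intro adjoint_reproducingI G_space_subset_completion G_completion_add G_completion_cmult P)
      (auto simp: G_completion_def)
  then show "adjoint_pair X F N \<Omega> G' (sup_norm \<Omega>) ?P \<phi>"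
    unfolding adjoint_pair_def using rkbs_F rkbs_G_completion by blast
  show "\<forall>f\<in>F. \<forall>g\<in>G. ?P f g = FG_pairing X \<Omega> \<phi> f g"
  proof (intro ballI)
    fix f g assume "f \<in> F" "g \<in> G"
    then obtain \<mu> where "signed_measure_on \<Omega> \<mu>" "f = A \<mu>" "g \<in> G'"
      using G_space_subset_completion by (auto simp: F_space_iff)
    then show "?P f g = FG_pairing X \<Omega> \<phi> f g"
      using P[of \<mu> g] FG_pairing_eq[of \<mu> g] \<open>g \<in> G\<close> by simp
  qed
qed

end

theorem corollary16:
  fixes X :: "(real ^ 'd) set" and \<Omega> :: "(real ^ 'e) set"
    and \<phi> :: "(real ^ 'd) \<times> (real ^ 'e) \<Rightarrow> real"
  assumes "closed X" and "closed \<Omega>" and "\<phi> \<in> C0 (X \<times> \<Omega>)"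
  shows "adjoint_pre_pair X (F_space X \<Omega> \<phi>) (F_norm X \<Omega> \<phi>)
           \<Omega> (G_space X \<Omega> \<phi>) (sup_norm \<Omega>) (FG_pairing X \<Omega> \<phi>) \<phi> \<and>
         (\<exists>P. (\<forall>f\<in>F_space X \<Omega> \<phi>. \<forall>g\<in>G_space X \<Omega> \<phi>. P f g = FG_pairing X \<Omega> \<phi> f g) \<and>
           adjoint_pair X (F_space X \<Omega> \<phi>) (F_norm X \<Omega> \<phi>)
             \<Omega> (G_completion X \<Omega> \<phi>) (sup_norm \<Omega>) P \<phi>)"
proof -
  interpret integral_kernel X \<Omega> \<phi> by unfold_locales fact+
  show ?thesis by (rule adjoint_pair_F_G)
qed

end
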